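(* Let $T\in\mathbb{R}^{n\times n}$ be nonsingular and consider the system obtained by the similarity transformation $\widetilde{x}_t=Tx_t$, $$\widetilde{x}_{t+1}=TAT^{-1}\widetilde{x}_t+TBu_t,\qquad y_t=CT^{-1}\widetilde{x}_t .$$ Let $\mathcal{K}=\{K\in\mathbb{R}^{m\times q}: K=K^*+\Delta,\ \Delta\in\mathbb{R}^{m\times q},\ \Delta S^\dagger=0\}$, where $K^*$ and $S$ are those of the original system $(A,B,C)$. Then $K$ is an optimal policy for the transformed system if and only if $K\in\mathcal{K}$.
   Context: Original system: $x_{t+1}=Ax_t+Bu_t$, $y_t=Cx_t$, with $x_t\in\mathbb{R}^n$, $u_t\in\mathbb{R}^m$, $y_t\in\mathbb{R}^d$. Standing assumptions: $(A,B)$ is controllable and $(C,A)$ is observable; the weights are symmetric, $Q\ge 0$ (size $d\times d$) and $R>0$ (size $m\times m$); the initial state $x_0$ is random with zero mean and covariance $\Sigma_0=\mathbb{E}[x_0x_0^\top]>0$. Let $p=\max\{o,c\}\le n$, where $o$ and $c$ are the observability and controllability indices, so that $\mathcal{O}=[(CA^{p-1})^\top,\dots,(CA)^\top,C^\top]^\top$ has full column rank and $\mathcal{C}=[B,AB,\dots,A^{p-1}B]$ has full row rank. Let $\mathcal{T}$ be the $p\times p$ block matrix with blocks in $\mathbb{R}^{d\times m}$ whose $(i,j)$ block is $CA^{j-i-1}B$ if $j>i$ and $0$ otherwise. Let $\mathcal{O}^\dagger=(\mathcal{O}^\top\mathcal{O})^{-1}\mathcal{O}^\top$, $q=p(m+d)$,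 and $$S=[\,\mathcal{C}-A^p\mathcal{O}^\dagger\mathcal{T},\ A^p\mathcal{O}^\dagger\,]\in\mathbb{R}^{n\times q}.$$ $S$ has full row rank; put $S^\dagger=S^\top(SS^\top)^{-1}$. With $z_{t,p}=[u_{t-1}^\top,\dots,u_{t-p}^\top,y_{t-1}^\top,\dots,y_{t-p}^\top]^\top$ one has $x_t=Sz_{t,p}$. The policies considered are $u_t=-Kz_{t,p}$ with $K\in\mathbb{R}^{m\times q}$, and the feasible set is $\mathcal{S}=\{K\in\mathbb{R}^{m\times q} : \rho(A-BKS^\dagger)<1\}$, where $\rho$ is the spectral radius. Put $Q_c=C^\top QC$. For $K\in\mathcal{S}$ the cost (of $\sum_{t\ge0}(y_t^\top Qy_t+u_t^\top Ru_t)$ in expectation over $x_0$) is given by $J(K)=\mathrm{Tr}(P_K\Sigma_0)$, where $P_K\ge0$ is the solution of $P_K=Q_c+(S^\dagger)^\top K^\top RKS^\dagger+(A-BKS^\dagger)^\top P_K(A-BKS^\dagger)$. $P^*$ is the unique positive semidefinite solution of the Riccati equation $P^*=A^\top P^*A+Q_c-A^\top P^*B(R+B^\top P^*B)^{-1}B^\top P^*A$, and $K^*=(R+B^\top P^*B)^{-1}B^\top P^*AS$, which is an optimal policy (in particular $K^*\in\mathcal{S}$). An optimal policy is a $K\in\mathcal{S}$ with $J(K)\le J(K')$ for all $K'\in\mathcal{S}$. For the transformed system, the matrix $\widetilde S$, the feasible set, the cost and the notion of optimal policy are defined by the same formulas with $(A,B,C)$ replaced by $(TAT^{-1},TB,CT^{-1})$,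 the same $Q,R,p$, and initial state $\widetilde x_0=Tx_0$ (covariance $T\Sigma_0T^\top$). *)

theory Defs
  imports "HOL-Probability.Probability_Measure"
    "Jordan_Normal_Form.Spectral_Radius"
    "Jordan_Normal_Form.DL_Rank"
    "Jordan_Normal_Form.Gauss_Jordan_Elimination"
begin

unbundle no vec_syntax
unbundle no inner_syntax

definition minv :: "real mat \<Rightarrow> real mat" where
  "minv M = the (mat_inverse M)"

definition mtrace :: "real mat \<Rightarrow> real" where
  "mtrace M = (\<Sum>i<dim_row M. M $$ (i, i))"

text \<open>Symmetry is part of both (semi)definiteness predicates.\<close>

definition psd :: "nat \<Rightarrow> real mat \<Rightarrow> bool" where
  "psd k M \<longleftrightarrow> M \<in> carrier_mat k k \<and> M\<^sup>T = M \<and>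
     (\<forall>x\<in>carrier_vec k. 0 \<le> x \<bullet> (M *\<^sub>v x))"

definition pd :: "nat \<Rightarrow> real mat \<Rightarrow> bool" where
  "pd k M \<longleftrightarrow> M \<in> carrier_mat k k \<and> M\<^sup>T = M \<and>
     (\<forall>x\<in>carrier_vec k. x \<noteq> 0\<^sub>v k \<longrightarrow> 0 < x \<bullet> (M *\<^sub>v x))"

text \<open>\<open>hcat X Y\<close> is the block row \<open>[X, Y]\<close>.\<close>

definition hcat :: "real mat \<Rightarrow> real mat \<Rightarrow> real mat" where
  "hcat X Y = four_block_mat X Y (0\<^sub>m 0 (dim_col X)) (0\<^sub>m 0 (dim_col Y))"

text \<open>
  The systems are \<open>x\<^sub>t\<^sub>+\<^sub>1 = A x\<^sub>t + B u\<^sub>t\<close>, \<open>y\<^sub>t = C x\<^sub>t\<close>. The state, input and output dimensions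
  are read off as \<open>dim_row A\<close>, \<open>dim_col B\<close> and \<open>dim_row C\<close>. Blocks are counted from 0, so the
  entry \<open>(i, j)\<close> of a matrix with \<open>d \<times> m\<close> blocks lies in block \<open>(i div d, j div m)\<close> at position
  \<open>(i mod d, j mod m)\<close>.

  \<open>obsv_mat k C A\<close> has the block rows \<open>C A\<^sup>k\<^sup>-\<^sup>1, \<dots>, C A, C\<close> (from top to bottom), and
  \<open>ctrb_mat k A B\<close> is \<open>[B, A B, \<dots>, A\<^sup>k\<^sup>-\<^sup>1 B]\<close>.
\<close>

definition obsv_mat :: "nat \<Rightarrow> real mat \<Rightarrow> real mat \<Rightarrow> real mat" where
  "obsv_mat k C A = (let d = dim_row C in
     mat (k * d) (dim_col C)
       (\<lambda>(i, j). (C * A ^\<^sub>m (k - 1 - i div d)) $$ (i mod d, j)))"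

definition ctrb_mat :: "nat \<Rightarrow> real mat \<Rightarrow> real mat \<Rightarrow> real mat" where
  "ctrb_mat k A B = (let m = dim_col B in
     mat (dim_row B) (k * m)
       (\<lambda>(i, j). (A ^\<^sub>m (j div m) * B) $$ (i, j mod m)))"

definition toeplitz_mat :: "nat \<Rightarrow> real mat \<Rightarrow> real mat \<Rightarrow> real mat \<Rightarrow> real mat" where
  "toeplitz_mat k A B C = (let d = dim_row C; m = dim_col B in
     mat (k * d) (k * m)
       (\<lambda>(i, j). if i div d < j div m
          then (C * A ^\<^sub>m (j div m - i div d - 1) * B) $$ (i mod d, j mod m)
          else 0))"

definition controllable :: "real mat \<Rightarrow> real mat \<Rightarrow> bool" where
  "controllable A B \<longleftrightarrow> vec_space.rank (dim_row A) (ctrb_mat (dim_row A) A B) = dim_row A"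

definition observable :: "real mat \<Rightarrow> real mat \<Rightarrow> bool" where
  "observable C A \<longleftrightarrow>
     vec_space.rank (dim_row A * dim_row C) (obsv_mat (dim_row A) C A) = dim_row A"

definition ctrb_index :: "real mat \<Rightarrow> real mat \<Rightarrow> nat" where
  "ctrb_index A B = (LEAST k. vec_space.rank (dim_row A) (ctrb_mat k A B) = dim_row A)"

definition obsv_index :: "real mat \<Rightarrow> real mat \<Rightarrow> nat" where
  "obsv_index C A = (LEAST k. vec_space.rank (k * dim_row C) (obsv_mat k C A) = dim_row A)"

text \<open>The pseudoinverse of a matrix of full column rank, resp. of full row rank.\<close>

definition left_pinv :: "real mat \<Rightarrow> real mat" where
  "left_pinv M = minv (M\<^sup>T * M) * M\<^sup>T"

definition right_pinv :: "real mat \<Rightarrow> real mat" where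
  "right_pinv M = M\<^sup>T * minv (M * M\<^sup>T)"

definition S_mat :: "nat \<Rightarrow> real mat \<Rightarrow> real mat \<Rightarrow> real mat \<Rightarrow> real mat" where
  "S_mat p A B C =
     hcat (ctrb_mat p A B - A ^\<^sub>m p * left_pinv (obsv_mat p C A) * toeplitz_mat p A B C)
          (A ^\<^sub>m p * left_pinv (obsv_mat p C A))"

definition S_pinv :: "nat \<Rightarrow> real mat \<Rightarrow> real mat \<Rightarrow> real mat \<Rightarrow> real mat" where
  "S_pinv p A B C = right_pinv (S_mat p A B C)"

definition closed_loop :: "nat \<Rightarrow> real mat \<Rightarrow> real mat \<Rightarrow> real mat \<Rightarrow> real mat \<Rightarrow> real mat" where
  "closed_loop p A B C K = A - B * K * S_pinv p A B C"

definition feasible :: "nat \<Rightarrow> real mat \<Rightarrow> real mat \<Rightarrow> real mat \<Rightarrow> real mat set" where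
  "feasible p A B C =
     {K \<in> carrier_mat (dim_col B) (p * (dim_col B + dim_row C)).
        spectral_radius (map_mat complex_of_real (closed_loop p A B C K)) < 1}"

definition value_mat ::
  "nat \<Rightarrow> real mat \<Rightarrow> real mat \<Rightarrow> real mat \<Rightarrow> real mat \<Rightarrow> real mat \<Rightarrow> real mat \<Rightarrow> real mat" where
  "value_mat p A B C Q R K = (THE P. psd (dim_row A) P \<and>
     P = C\<^sup>T * Q * C + (S_pinv p A B C)\<^sup>T * K\<^sup>T * R * K * S_pinv p A B C
       + (closed_loop p A B C K)\<^sup>T * P * closed_loop p A B C K)"

definition cost ::
  "nat \<Rightarrow> real mat \<Rightarrow> real mat \<Rightarrow> real mat \<Rightarrow> real mat \<Rightarrow> real mat \<Rightarrow> real mat \<Rightarrow> real mat \<Rightarrow> real" where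
  "cost p A B C Q R \<Sigma> K = mtrace (value_mat p A B C Q R K * \<Sigma>)"

definition optimal_policy ::
  "nat \<Rightarrow> real mat \<Rightarrow> real mat \<Rightarrow> real mat \<Rightarrow> real mat \<Rightarrow> real mat \<Rightarrow> real mat \<Rightarrow> real mat \<Rightarrow> bool" where
  "optimal_policy p A B C Q R \<Sigma> K \<longleftrightarrow> K \<in> feasible p A B C \<and>
     (\<forall>K'\<in>feasible p A B C. cost p A B C Q R \<Sigma> K \<le> cost p A B C Q R \<Sigma> K')"

definition riccati_psd_solution ::
  "real mat \<Rightarrow> real mat \<Rightarrow> real mat \<Rightarrow> real mat \<Rightarrow> real mat \<Rightarrow> real mat \<Rightarrow> bool" where
  "riccati_psd_solution A B C Q R P \<longleftrightarrow> psd (dim_row A) P \<and>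
     P = A\<^sup>T * P * A + C\<^sup>T * Q * C
       - A\<^sup>T * P * B * minv (R + B\<^sup>T * P * B) * B\<^sup>T * P * A"

definition K_opt ::
  "nat \<Rightarrow> real mat \<Rightarrow> real mat \<Rightarrow> real mat \<Rightarrow> real mat \<Rightarrow> real mat \<Rightarrow> real mat" where
  "K_opt p A B C R P = minv (R + B\<^sup>T * P * B) * B\<^sup>T * P * A * S_mat p A B C"

definition square_integrable_vec :: "nat \<Rightarrow> 'w measure \<Rightarrow> ('w \<Rightarrow> real Matrix.vec) \<Rightarrow> bool" where
  "square_integrable_vec n \<Omega> x \<longleftrightarrow> (\<forall>\<omega>\<in>space \<Omega>. x \<omega> \<in> carrier_vec n) \<and>
     (\<forall>i<n. (\<lambda>\<omega>. x \<omega> $ i) \<in> borel_measurable \<Omega> \<and> integrable \<Omega> (\<lambda>\<omega>. (x \<omega> $ i)\<^sup>2))"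

text \<open>\<open>E[x x\<^sup>T]\<close>, which is the covariance matrix of \<open>x\<close> when \<open>x\<close> has zero mean.\<close>

definition second_moment :: "nat \<Rightarrow> 'w measure \<Rightarrow> ('w \<Rightarrow> real Matrix.vec) \<Rightarrow> real mat" where
  "second_moment n \<Omega> x = mat n n (\<lambda>(i, j). \<integral>\<omega>. x \<omega> $ i * x \<omega> $ j \<partial>\<Omega>)"

end

theory Submission
  imports Defs
begin

text \<open>
  A policy \<open>K\<close> acts on the state only through the feedback \<open>K S\<^sup>\<dagger>\<close>: both the closed loop
  \<open>A - B K S\<^sup>\<dagger>\<close> and the equation for the value matrix contain \<open>K\<close> in this combination. The argument has
  two parts. A change of coordinates does not affect which policies are optimal, and in the original
  coordinates the optimal policies are exactly those whose feedback is the Riccati gain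
  \<open>(R + B\<^sup>T P B)\<inverse> B\<^sup>T P A\<close>. Since \<open>S S\<^sup>\<dagger> = 1\<close>, this gain is \<open>K\<^sup>* S\<^sup>\<dagger>\<close>, so a policy has it if and only if it
  differs from \<open>K\<^sup>*\<close> by some \<open>\<Delta>\<close> with \<open>\<Delta> S\<^sup>\<dagger> = 0\<close>.

  Change of coordinates (\<open>similar_optimal_policy\<close>). Inputs and outputs are the same in both
  representations, so the matrix that reconstructs the state from them becomes \<open>T S\<close>. As \<open>S\<close> has full row
  rank, its pseudoinverse becomes \<open>S\<^sup>\<dagger> T\<inverse>\<close>, and the closed loops under one and the same \<open>K\<close> are
  similar. Hence the feasible sets agree. Value matrices and second moments transform by inverse
  congruences, so the costs agree as well.

  Optimality (\<open>optimal_policy_iff\<close>). Let \<open>M = R + B\<^sup>T P B\<close>, let \<open>L\<close> be the feedback of a feasible policy,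
  \<open>L\<^sup>*\<close> the Riccati gain and \<open>F = A - B L\<close>. Completing the square shows that the value matrix is \<open>P + D\<close>,
  where \<open>D\<close> solves the Lyapunov equation \<open>D = (L - L\<^sup>*)\<^sup>T M (L - L\<^sup>*) + F\<^sup>T D F\<close> (\<open>value_mat_gap\<close>). The matrix
  \<open>D\<close> is positive semidefinite, and its contribution to the cost is the expectation of \<open>x\<^sub>0 \<bullet> D x\<^sub>0\<close>. With a
  definite second moment this expectation is positive unless \<open>D = 0\<close> (\<open>trace_psd_second_moment\<close>), and
  \<open>D = 0\<close> forces \<open>L = L\<^sup>*\<close> because \<open>M\<close> is definite.

  Both parts rest on existence and uniqueness for the Lyapunov equation of a matrix with spectral
  radius below one (\<open>lyapunov_exists\<close>, \<open>lyapunov_unique\<close>), which in turn rest on the geometric decay of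
  its powers (\<open>powers_decay_geometrically\<close>).
\<close>

section \<open>Matrix algebra, inverses and rank\<close>

text \<open>
  The ring laws are restated with equations between dimensions in place of carrier sets. A carrier
  premise mentions inner dimensions that do not occur in the goal, so rewriting cannot solve it; an
  equation between dimensions is itself decided by rewriting. With these forms \<open>simp\<close> brings products of
  rectangular matrices to a sum of right-nested products.
\<close>

lemma assoc_mult_dim:
  "dim_col X = dim_row Y \<Longrightarrow> dim_col Y = dim_row Z \<Longrightarrow> X * Y * Z = X * (Y * (Z :: real mat))"
  by (rule assoc_mult_mat[of _ "dim_row X" "dim_row Y" _ "dim_row Z" _ "dim_col Z"]) auto

lemma mult_add_distrib_dim:
  "dim_col X = dim_row Y \<Longrightarrow> dim_row Y = dim_row Z \<Longrightarrow> dim_col Y = dim_col Z \<Longrightarrow> X * (Y + Z) = X * Y + X * (Z :: real mat)"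
  by (rule mult_add_distrib_mat[of _ "dim_row X" "dim_row Y" _ "dim_col Y"]) auto

lemma add_mult_distrib_dim:
  "dim_col X = dim_row Z \<Longrightarrow> dim_row Y = dim_row X \<Longrightarrow> dim_col Y = dim_col X \<Longrightarrow> (X + Y) * Z = X * Z + Y * (Z :: real mat)"
  by (rule add_mult_distrib_mat[of _ "dim_row X" "dim_col X" _ _ "dim_col Z"]) auto

lemma mult_minus_distrib_dim:
  "dim_col X = dim_row Y \<Longrightarrow> dim_row Y = dim_row Z \<Longrightarrow> dim_col Y = dim_col Z \<Longrightarrow> X * (Y - Z) = X * Y - X * (Z :: real mat)"
  by (rule mult_minus_distrib_mat[of _ "dim_row X" "dim_row Y" _ "dim_col Y"]) auto

lemma minus_mult_distrib_dim:
  "dim_col X = dim_row Z \<Longrightarrow> dim_row Y = dim_row X \<Longrightarrow> dim_col Y = dim_col X \<Longrightarrow> (X - Y) * Z = X * Z - Y * (Z :: real mat)"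
  by (rule minus_mult_distrib_mat[of _ "dim_row X" "dim_col X" _ _ "dim_col Z"]) auto

lemma transpose_mult_dim: "dim_col X = dim_row Y \<Longrightarrow> (X * Y)\<^sup>T = Y\<^sup>T * (X :: real mat)\<^sup>T"
  by (rule transpose_mult[of _ "dim_row X" "dim_row Y" _ "dim_col Y"]) auto

lemma transpose_add_dim:
  "dim_row Y = dim_row X \<Longrightarrow> dim_col Y = dim_col X \<Longrightarrow> (X + Y)\<^sup>T = X\<^sup>T + (Y :: real mat)\<^sup>T"
  by (rule transpose_add[of _ "dim_row X" "dim_col X"]) auto

lemma transpose_minus_dim:
  "dim_row Y = dim_row X \<Longrightarrow> dim_col Y = dim_col X \<Longrightarrow> (X - Y)\<^sup>T = X\<^sup>T - (Y :: real mat)\<^sup>T"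
  by (rule eq_matI) auto

lemma mult_mat_vec_dim:
  "dim_col X = dim_row Y \<Longrightarrow> dim_col Y = dim_vec v \<Longrightarrow> X * Y *\<^sub>v v = X *\<^sub>v (Y *\<^sub>v (v :: real Matrix.vec))"
  by (rule assoc_mult_mat_vec[of _ "dim_row X" "dim_row Y" _ "dim_vec v"]) auto

lemmas mat_distribs = assoc_mult_dim mult_add_distrib_dim add_mult_distrib_dim
  mult_minus_distrib_dim minus_mult_distrib_dim transpose_mult_dim transpose_add_dim transpose_minus_dim

text \<open>
  In a right-nested product a factor and its inverse stand in front of a remainder \<open>X\<close>; this is the
  form in which they cancel.
\<close>

lemma left_cancel_dim:
  assumes "M * N = 1\<^sub>m k" "dim_col M = dim_row N" "dim_col N = k" "dim_row X = k"
  shows "M * (N * X) = (X :: real mat)"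
proof -
  have "M * (N * X) = (M * N) * X" using assms(2-4) by (simp add: assoc_mult_dim)
  then show ?thesis using assms(1,4) by simp
qed

lemma scalar_prod_transpose:
  fixes M :: "real mat"
  assumes "dim_vec x = dim_row M" "dim_vec y = dim_col M"
  shows "x \<bullet> (M *\<^sub>v y) = (M\<^sup>T *\<^sub>v x) \<bullet> y"
proof -
  have M: "M \<in> carrier_mat (dim_row M) (dim_col M)" by simp
  have x: "x \<in> carrier_vec (dim_row M)" and y: "y \<in> carrier_vec (dim_col M)"
    using assms by (auto intro!: carrier_vecI)
  show ?thesis by (rule transpose_vec_mult_scalar[OF M y x, symmetric])
qed

lemma quadform_sum:
  fixes M :: "real mat"
  assumes "M \<in> carrier_mat k k" "x \<in> carrier_vec k"
  shows "x \<bullet> (M *\<^sub>v x) = (\<Sum>i<k. \<Sum>j<k. x $ i * M $$ (i, j) * x $ j)"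
  using assms by (auto simp: scalar_prod_def sum_distrib_left atLeast0LessThan mult.assoc intro!: sum.cong)

lemma scalar_prod_self_zero:
  fixes v :: "real Matrix.vec"
  assumes "v \<in> carrier_vec k" "v \<bullet> v = 0"
  shows "v = 0\<^sub>v k"
proof -
  have "(\<Sum>i\<in>{0..<k}. v $ i * v $ i) = 0" using assms by (auto simp: scalar_prod_def)
  then have "\<forall>i\<in>{0..<k}. v $ i * v $ i = 0"
    by (subst (asm) sum_nonneg_eq_0_iff) auto
  then show ?thesis using assms(1) by (intro eq_vecI) auto
qed

text \<open>
  Gauss-Jordan elimination fails only on matrices that are not units, so for a nonzero determinant
  the value of \<open>minv\<close> is not the unspecified one.
\<close>

lemma minv_inverts:
  assumes "M \<in> carrier_mat k k" "det M \<noteq> 0"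
  shows "minv M \<in> carrier_mat k k" "M * minv M = 1\<^sub>m k" "minv M * M = 1\<^sub>m k"
proof -
  have "M \<in> Units (ring_mat TYPE(real) k ())" using det_non_zero_imp_unit[OF assms] .
  then obtain N where "mat_inverse M = Some N" 
    using mat_inverse(1)[OF assms(1), where b = "()"] by (cases "mat_inverse M") auto
  then show "minv M \<in> carrier_mat k k" "M * minv M = 1\<^sub>m k" "minv M * M = 1\<^sub>m k"
    using mat_inverse(2)[OF assms(1)] by (auto simp: minv_def)
qed

lemma minv_unique:
  assumes M: "M \<in> carrier_mat k k" and N: "N \<in> carrier_mat k k" and MN: "M * N = 1\<^sub>m k"
  shows "minv M = N"
proof -
  have "det M * det N = 1" using det_mult[OF M N] MN by simp
  then have "det M \<noteq> 0" by auto
  note i = minv_inverts[OF M this]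
  have "minv M = minv M * (M * N)" using i(1) MN by simp
  also have "\<dots> = (minv M * M) * N" using assoc_mult_mat[OF i(1) M N] by simp
  also have "\<dots> = N" using i(3) N by simp
  finally show ?thesis .
qed

lemma det_nonzero_if_kernel_trivial:
  assumes "(M :: real mat) \<in> carrier_mat k k" "\<And>v. v \<in> carrier_vec k \<Longrightarrow> M *\<^sub>v v = 0\<^sub>v k \<Longrightarrow> v = 0\<^sub>v k"
  shows "det M \<noteq> 0"
  using det_0_iff_vec_prod_zero_field[OF assms(1)] assms(2) by auto

text \<open>
  \<open>v \<bullet> M\<^sup>T M v\<close> is the squared length of \<open>M v\<close>, so \<open>M\<^sup>T M\<close> has no more kernel than \<open>M\<close>.
\<close>

lemma gram_det_nonzero:
  fixes M :: "real mat"
  assumes M: "M \<in> carrier_mat k l"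
    and ker: "\<And>v. v \<in> carrier_vec l \<Longrightarrow> M *\<^sub>v v = 0\<^sub>v k \<Longrightarrow> v = 0\<^sub>v l"
  shows "det (M\<^sup>T * M) \<noteq> 0"
proof (rule det_nonzero_if_kernel_trivial)
  show "M\<^sup>T * M \<in> carrier_mat l l" using M by auto
  fix v :: "real Matrix.vec" assume v: "v \<in> carrier_vec l" and "M\<^sup>T * M *\<^sub>v v = 0\<^sub>v l"
  then have "v \<bullet> (M\<^sup>T *\<^sub>v (M *\<^sub>v v)) = 0" using M by (simp add: mult_mat_vec_dim)
  then have "(M *\<^sub>v v) \<bullet> (M *\<^sub>v v) = 0"
    using M v scalar_prod_transpose[of v "M\<^sup>T" "M *\<^sub>v v"] by simp
  then have "M *\<^sub>v v = 0\<^sub>v k" using scalar_prod_self_zero[of "M *\<^sub>v v" k] M v by auto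
  then show "v = 0\<^sub>v l" using ker v by blast
qed

lemma pd_det_nonzero:
  assumes "pd k M" shows "det M \<noteq> 0"
proof (rule det_nonzero_if_kernel_trivial)
  show "M \<in> carrier_mat k k" using assms by (simp add: pd_def)
  fix v :: "real Matrix.vec" assume v: "v \<in> carrier_vec k" "M *\<^sub>v v = 0\<^sub>v k"
  then have "v \<bullet> (M *\<^sub>v v) = 0" by simp
  then show "v = 0\<^sub>v k" using assms v(1) unfolding pd_def by force
qed

lemma invertible_mat_det_nonzero:
  fixes T :: "real mat"
  assumes T: "T \<in> carrier_mat n n" and "invertible_mat T"
  shows "det T \<noteq> 0"
proof -
  obtain N where N: "T * N = 1\<^sub>m n" "N * T = 1\<^sub>m (dim_row N)"
    using assms by (auto simp: invertible_mat_def inverts_mat_def)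
  have "dim_col N = n" using arg_cong[OF N(1), of dim_col] by simp
  moreover have "dim_row N = n" using arg_cong[OF N(2), of dim_col] T by simp
  ultimately have "N \<in> carrier_mat n n" by (rule carrier_matI[rotated])
  then have "det T * det N = 1" using det_mult[OF T] N(1) by (metis det_one)
  then show ?thesis by auto
qed

text \<open>
  The rank is the dimension of the span of the set of columns. Full column rank therefore first has
  to exclude repeated columns, by counting a maximal independent set; only then does linear
  independence of that set say something about the kernel.
\<close>

lemma full_col_rank_kernel:
  fixes M :: "real mat"
  assumes M: "M \<in> carrier_mat k l" and r: "vec_space.rank k M = l"
    and v: "v \<in> carrier_vec l" "M *\<^sub>v v = 0\<^sub>v k"
  shows "v = 0\<^sub>v l"
proof -
  interpret vec_space "TYPE(real)" k .
  obtain U where U: "maximal U (\<lambda>T. T \<subseteq> set (cols M) \<and> lin_indpt T)"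
    using maximal_exists[of "(\<lambda>T. T \<subseteq> set (cols M) \<and> lin_indpt T)" "card (set (cols M))" "{}"]
    by (meson List.finite_set card_mono empty_iff empty_subsetI finite_lin_indpt2 rev_finite_subset)
  then have "card U \<le> card (set (cols M))" by (simp add: card_mono maximal_def)
  then have "l \<le> card (set (cols M))" using rank_card_indpt[OF M U] r by simp
  then have dist: "distinct (cols M)"
    using M card_length[of "cols M"] by (auto intro!: card_distinct)
  show ?thesis
    using lin_depI[OF M v(1) _ v(2) dist] full_rank_lin_indpt[OF M r dist] by blast
qed

text \<open>
  A maximal independent set of columns has as many members as there are rows, so these columns form
  a nonsingular square matrix. A vector orthogonal to all columns lies in the kernel of its transpose.
\<close>

lemma full_row_rank_kernel:
  fixes M :: "real mat"
  assumes M: "M \<in> carrier_mat k l" and r: "vec_space.rank k M = k"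
    and v: "v \<in> carrier_vec k" "M\<^sup>T *\<^sub>v v = 0\<^sub>v l"
  shows "v = 0\<^sub>v k"
proof -
  interpret vec_space "TYPE(real)" k .
  obtain U where U: "maximal U (\<lambda>T. T \<subseteq> set (cols M) \<and> lin_indpt T)"
    using maximal_exists[of "(\<lambda>T. T \<subseteq> set (cols M) \<and> lin_indpt T)" "card (set (cols M))" "{}"]
    by (meson List.finite_set card_mono empty_iff empty_subsetI finite_lin_indpt2 rev_finite_subset)
  then have cU: "card U = k" and UM: "U \<subseteq> set (cols M)" and li: "lin_indpt U"
    using rank_card_indpt[OF M U] r by (auto simp: maximal_def)
  have "finite U" using UM finite_subset by blast
  then obtain us where us: "set us = U" "distinct us" using finite_distinct_list by blast
  have lus: "length us = k" using us cU distinct_card by fastforce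
  have cd: "set us \<subseteq> carrier_vec k" using us UM M cols_dim by blast
  let ?N = "mat_of_cols k us"
  have N: "?N \<in> carrier_mat k k" and cN: "cols ?N = us" using lus cd by auto
  have "rank ?N = k" using lin_indpt_full_rank[OF N] cN us li by simp
  then have dN: "det (?N\<^sup>T) \<noteq> 0" using det_rank_iff[OF N] det_transpose[OF N] by simp
  have "?N\<^sup>T *\<^sub>v v = 0\<^sub>v k"
  proof (rule eq_vecI)
    fix i assume i: "i < dim_vec (0\<^sub>v k :: real Matrix.vec)"
    then have "us ! i \<in> set (cols M)" using us UM lus by auto
    then obtain j where j: "j < l" "us ! i = col M j"
      using M by (metis carrier_matD(2) cols_length cols_nth in_set_conv_nth)
    have "(?N\<^sup>T *\<^sub>v v) $ i = us ! i \<bullet> v"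
      using i lus N cd col_mat_of_cols[of i us k] nth_mem[of i us] by (simp add: subset_iff)
    also have "\<dots> = (M\<^sup>T *\<^sub>v v) $ j" using j M by simp
    also have "\<dots> = 0" using v j by simp
    finally show "(?N\<^sup>T *\<^sub>v v) $ i = (0\<^sub>v k :: real Matrix.vec) $ i" using i by simp
  qed (use N in auto)
  then show ?thesis using det_0_iff_vec_prod_zero_field[of "?N\<^sup>T" k] dN N v(1) by auto
qed

section \<open>Lyapunov equations\<close>

lemma pow_mat_smult:
  fixes M :: "'a :: comm_ring_1 mat"
  assumes M: "M \<in> carrier_mat n n"
  shows "(a \<cdot>\<^sub>m M) ^\<^sub>m k = a ^ k \<cdot>\<^sub>m (M ^\<^sub>m k)"
proof (induction k)
  case 0
  then show ?case using M by (intro eq_matI) auto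
next
  case (Suc k)
  have Mk: "M ^\<^sub>m k \<in> carrier_mat n n" using M by simp
  have "(a \<cdot>\<^sub>m M) ^\<^sub>m Suc k = (a ^ k \<cdot>\<^sub>m (M ^\<^sub>m k)) * (a \<cdot>\<^sub>m M)" using Suc by simp
  also have "\<dots> = a ^ k \<cdot>\<^sub>m (M ^\<^sub>m k * (a \<cdot>\<^sub>m M))"
    using mult_smult_assoc_mat[OF Mk, of "a \<cdot>\<^sub>m M" n] M by simp
  also have "M ^\<^sub>m k * (a \<cdot>\<^sub>m M) = a \<cdot>\<^sub>m (M ^\<^sub>m k * M)"
    using mult_smult_distrib[OF Mk M] .
  also have "a ^ k \<cdot>\<^sub>m (a \<cdot>\<^sub>m (M ^\<^sub>m k * M)) = a ^ Suc k \<cdot>\<^sub>m (M ^\<^sub>m Suc k)"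
    by (rule eq_matI) auto
  finally show ?case .
qed

lemma norm_boundD:
  "norm_bound M c \<Longrightarrow> M \<in> carrier_mat k l \<Longrightarrow> i < k \<Longrightarrow> j < l \<Longrightarrow> norm (M $$ (i, j)) \<le> c"
  by (auto simp: norm_bound_def)

text \<open>
  For spectral radius below one the Jordan normal form gives bounded powers. Geometric decay follows
  by applying this bound to \<open>F / r\<close> for some \<open>r < 1\<close> above the spectral radius of \<open>F\<close>.
\<close>

lemma powers_decay_geometrically:
  fixes F :: "real mat"
  assumes F: "F \<in> carrier_mat n n" and n: "0 < n"
    and sr: "spectral_radius (map_mat complex_of_real F) < 1"
  obtains c r where "0 \<le> c" "0 < r" "r < 1"
    "\<And>k i j. i < n \<Longrightarrow> j < n \<Longrightarrow> \<bar>(F ^\<^sub>m k) $$ (i, j)\<bar> \<le> c * r ^ k"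
proof -
  let ?F = "map_mat complex_of_real F"
  have cF: "?F \<in> carrier_mat n n" using F by simp
  have rho0: "0 \<le> spectral_radius ?F" using spectral_radius_mem_max(1)[OF cF n] by auto
  \<comment> \<open>any number strictly between the spectral radius and one\<close>
  define r where "r = (1 + spectral_radius ?F) / 2"
  have r: "0 < r" "r < 1" "spectral_radius ?F < r" using rho0 sr by (auto simp: r_def)
  let ?a = "complex_of_real (1 / r)"
  let ?G = "?a \<cdot>\<^sub>m ?F"
  have cG: "?G \<in> carrier_mat n n" using cF by simp
  have "spectral_radius ?G < 1"
  proof -
    obtain e where e: "eigenvalue ?G e" "spectral_radius ?G = norm e"
      using spectral_radius_mem_max(1)[OF cG n] by (auto simp: spectrum_def)
    then obtain v where v: "v \<in> carrier_vec n" "v \<noteq> 0\<^sub>v n" "?G *\<^sub>v v = e \<cdot>\<^sub>v v"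
      unfolding eigenvalue_def eigenvector_def using F by auto
    have "?F *\<^sub>v v = (complex_of_real r * e) \<cdot>\<^sub>v v"
    proof (rule eq_vecI)
      fix i assume "i < dim_vec ((complex_of_real r * e) \<cdot>\<^sub>v v)"
      then have i: "i < n" using v by simp
      have "(?G *\<^sub>v v) $ i = ?a * (?F *\<^sub>v v) $ i"
        using i F v(1) by (simp add: scalar_prod_def sum_divide_distrib)
      then have "?a * (?F *\<^sub>v v) $ i = e * v $ i" using v i by simp
      then show "(?F *\<^sub>v v) $ i = ((complex_of_real r * e) \<cdot>\<^sub>v v) $ i"
        using r i v by (simp add: field_simps)
    qed (use F v in auto)
    then have "eigenvalue ?F (complex_of_real r * e)"
      unfolding eigenvalue_def eigenvector_def using F v by auto
    then have "norm (complex_of_real r * e) \<le> spectral_radius ?F"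
      by (intro spectral_radius_mem_max(2)[OF cF n]) (auto simp: spectrum_def)
    then have "r * norm e \<le> spectral_radius ?F" using r by (simp add: norm_mult)
    then have "r * norm e < r * 1" using r(3) by linarith
    then show ?thesis using r(1) e(2) by (simp only: mult_less_cancel_left_pos)
  qed
  then obtain c where c: "\<And>k. norm_bound (?G ^\<^sub>m k) c"
    using spectral_radius_jnf_norm_bound_less_1_upper_triangular[OF cG] by blast
  have bound: "\<bar>(F ^\<^sub>m k) $$ (i, j)\<bar> \<le> max c 0 * r ^ k" if ij: "i < n" "j < n" for k i j
  proof -
    have "?G ^\<^sub>m k = ?a ^ k \<cdot>\<^sub>m map_mat complex_of_real (F ^\<^sub>m k)"
      by (simp only: pow_mat_smult[OF cF] of_real_hom.mat_hom_pow[OF F])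
    moreover have Fk: "F ^\<^sub>m k \<in> carrier_mat n n" by (rule pow_carrier_mat[OF F])
    ultimately have "(?G ^\<^sub>m k) $$ (i, j) = ?a ^ k * complex_of_real ((F ^\<^sub>m k) $$ (i, j))"
      using ij carrier_matD[OF Fk] by simp
    moreover have "norm ((?G ^\<^sub>m k) $$ (i, j)) \<le> c"
      by (rule norm_boundD[OF c pow_carrier_mat[OF cG] ij])
    ultimately have "(1 / r) ^ k * \<bar>(F ^\<^sub>m k) $$ (i, j)\<bar> \<le> c"
      using r by (simp add: norm_mult norm_power norm_divide)
    then have "\<bar>(F ^\<^sub>m k) $$ (i, j)\<bar> \<le> c * r ^ k" using r by (simp add: field_simps)
    also have "\<dots> \<le> max c 0 * r ^ k" using r by (intro mult_right_mono) auto
    finally show ?thesis .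
  qed
  show thesis by (rule that[of "max c 0" r]) (use r bound in auto)
qed

lemma congruence_entry:
  fixes G W :: "real mat"
  assumes "G \<in> carrier_mat n l" "W \<in> carrier_mat n n" "i < l" "j < l"
  shows "(G\<^sup>T * W * G) $$ (i, j) = (\<Sum>a<n. \<Sum>b<n. G $$ (a, i) * W $$ (a, b) * G $$ (b, j))"
proof -
  have "(G\<^sup>T * W * G) $$ (i, j) = (G\<^sup>T * (W * G)) $$ (i, j)"
    using assms by (simp add: assoc_mult_dim)
  also have "\<dots> = (\<Sum>a<n. \<Sum>b<n. G $$ (a, i) * W $$ (a, b) * G $$ (b, j))"
    using assms by (simp add: scalar_prod_def atLeast0LessThan sum_distrib_left mult.assoc del: assoc_mult_mat)
  finally show ?thesis .
qed

lemma congruence_psd: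
  assumes G: "G \<in> carrier_mat n l" and W: "psd n W"
  shows "psd l (G\<^sup>T * W * G)"
proof -
  have cW: "W \<in> carrier_mat n n" and tW: "W\<^sup>T = W" using W by (auto simp: psd_def)
  have "0 \<le> x \<bullet> (G\<^sup>T * W * G *\<^sub>v x)" if x: "x \<in> carrier_vec l" for x
  proof -
    have "G\<^sup>T * W * G *\<^sub>v x = G\<^sup>T *\<^sub>v (W *\<^sub>v (G *\<^sub>v x))"
      using G cW x by (simp add: mult_mat_vec_dim)
    then have "x \<bullet> (G\<^sup>T * W * G *\<^sub>v x) = (G *\<^sub>v x) \<bullet> (W *\<^sub>v (G *\<^sub>v x))"
      using scalar_prod_transpose[of x "G\<^sup>T" "W *\<^sub>v (G *\<^sub>v x)"] G cW x by simp
    also have "\<dots> \<ge> 0" using W G x by (simp add: psd_def)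
    finally show ?thesis .
  qed
  then show ?thesis using G cW tW by (simp add: psd_def mat_distribs)
qed

lemma psd_add: "psd n X \<Longrightarrow> psd n Y \<Longrightarrow> psd n (X + Y)"
  unfolding psd_def
  by (auto simp: transpose_add_dim add_mult_distrib_mat_vec[of _ n n] scalar_prod_add_distrib[of _ n])

lemma congruence_power_bound:
  fixes F W :: "real mat"
  assumes F: "F \<in> carrier_mat n n" and W: "W \<in> carrier_mat n n" and r: "0 < r" and c: "0 \<le> c"
    and bd: "\<And>k i j. i < n \<Longrightarrow> j < n \<Longrightarrow> \<bar>(F ^\<^sub>m k) $$ (i, j)\<bar> \<le> c * r ^ k"
    and ij: "i < n" "j < n"
  shows "\<bar>((F ^\<^sub>m k)\<^sup>T * W * F ^\<^sub>m k) $$ (i, j)\<bar>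
    \<le> (\<Sum>a<n. \<Sum>b<n. c * \<bar>W $$ (a, b)\<bar> * c) * (r\<^sup>2) ^ k"
proof -
  have Fk: "F ^\<^sub>m k \<in> carrier_mat n n" using F by simp
  have *: "\<bar>(F ^\<^sub>m k) $$ (a, i) * W $$ (a, b) * (F ^\<^sub>m k) $$ (b, j)\<bar>
      \<le> (c * \<bar>W $$ (a, b)\<bar> * c) * (r\<^sup>2) ^ k" if "a < n" "b < n" for a b
  proof -
    have "\<bar>(F ^\<^sub>m k) $$ (a, i) * W $$ (a, b) * (F ^\<^sub>m k) $$ (b, j)\<bar>
        \<le> (c * r ^ k) * \<bar>W $$ (a, b)\<bar> * (c * r ^ k)"
      unfolding abs_mult using bd[of a i k] bd[of b j k] that ij r c by (intro mult_mono) auto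
    also have "\<dots> = (c * \<bar>W $$ (a, b)\<bar> * c) * (r\<^sup>2) ^ k"
      by (simp add: power2_eq_square power_mult_distrib)
    finally show ?thesis .
  qed
  have "\<bar>((F ^\<^sub>m k)\<^sup>T * W * F ^\<^sub>m k) $$ (i, j)\<bar>
      \<le> (\<Sum>a<n. \<Sum>b<n. \<bar>(F ^\<^sub>m k) $$ (a, i) * W $$ (a, b) * (F ^\<^sub>m k) $$ (b, j)\<bar>)"
    unfolding congruence_entry[OF Fk W ij]
    by (rule order_trans[OF sum_abs sum_mono[OF sum_abs]])
  also have "\<dots> \<le> (\<Sum>a<n. \<Sum>b<n. (c * \<bar>W $$ (a, b)\<bar> * c) * (r\<^sup>2) ^ k)"
    by (intro sum_mono *) auto
  finally show ?thesis by (simp add: sum_distrib_right)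
qed

text \<open>
  The difference \<open>Z\<close> of two solutions satisfies \<open>Z = F\<^sup>T Z F\<close>, hence \<open>Z = (F\<^sup>k)\<^sup>T Z F\<^sup>k\<close> for all \<open>k\<close>, and
  the right-hand side tends to zero.
\<close>

lemma lyapunov_unique:
  fixes F X Y W :: "real mat"
  assumes F: "F \<in> carrier_mat n n" and n: "0 < n"
    and sr: "spectral_radius (map_mat complex_of_real F) < 1"
    and W: "W \<in> carrier_mat n n" and X: "X \<in> carrier_mat n n" and Y: "Y \<in> carrier_mat n n"
    and eX: "X = W + F\<^sup>T * X * F" and eY: "Y = W + F\<^sup>T * Y * F"
  shows "X = Y"
proof -
  let ?Z = "X - Y"
  have Z: "?Z \<in> carrier_mat n n" using X Y by auto
  have "F\<^sup>T * ?Z * F = F\<^sup>T * X * F - F\<^sup>T * Y * F" using F X Y by (simp add: mat_distribs)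
  also have "\<dots> = (W + F\<^sup>T * X * F) - (W + F\<^sup>T * Y * F)"
    by (rule eq_matI) (use W F X Y in \<open>auto simp del: index_mult_mat(1)\<close>)
  finally have step: "F\<^sup>T * ?Z * F = ?Z" using eX eY by simp
  have iter: "(F ^\<^sub>m k)\<^sup>T * ?Z * F ^\<^sub>m k = ?Z" for k
  proof (induction k)
    case 0
    then show ?case using F left_mult_one_mat[OF Z] right_mult_one_mat[OF Z] by simp
  next
    case (Suc k)
    have Fk: "F ^\<^sub>m k \<in> carrier_mat n n" using F by simp
    have "(F ^\<^sub>m Suc k)\<^sup>T * ?Z * F ^\<^sub>m Suc k = F\<^sup>T * ((F ^\<^sub>m k)\<^sup>T * ?Z * F ^\<^sub>m k) * F"
      using F Fk X Y by (simp add: assoc_mult_dim transpose_mult_dim)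
    then show ?case using Suc step by simp
  qed
  obtain c r where cr: "0 \<le> c" "0 < r" "r < 1"
    "\<And>k i j. i < n \<Longrightarrow> j < n \<Longrightarrow> \<bar>(F ^\<^sub>m k) $$ (i, j)\<bar> \<le> c * r ^ k"
    using powers_decay_geometrically[OF F n sr] by blast
  have "?Z $$ (i, j) = 0" if ij: "i < n" "j < n" for i j
  proof -
    let ?c = "\<Sum>a<n. \<Sum>b<n. c * \<bar>?Z $$ (a, b)\<bar> * c"
    have b: "\<bar>?Z $$ (i, j)\<bar> \<le> ?c * (r\<^sup>2) ^ k" for k
      using congruence_power_bound[OF F Z cr(2,1) cr(4) ij, of k] unfolding iter .
    have "r\<^sup>2 < 1" using cr by (simp add: power_less_one_iff)
    then have "(\<lambda>k. ?c * (r\<^sup>2) ^ k) \<longlonglongrightarrow> ?c * 0"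
      by (intro tendsto_mult tendsto_const LIMSEQ_realpow_zero) auto
    then have "\<bar>?Z $$ (i, j)\<bar> \<le> ?c * 0"
      by (rule LIMSEQ_le_const) (use b in blast)
    then show ?thesis by simp
  qed
  then show ?thesis using X Y by (intro eq_matI) auto
qed

text \<open>
  The solution is the series of the matrices \<open>(F\<^sup>k)\<^sup>T W F\<^sup>k\<close>: congruence with \<open>F\<close> shifts it by one
  place, and as a limit of sums of semidefinite matrices it is semidefinite.
\<close>

lemma lyapunov_exists:
  fixes F W :: "real mat"
  assumes F: "F \<in> carrier_mat n n" and n: "0 < n"
    and sr: "spectral_radius (map_mat complex_of_real F) < 1"
    and W: "psd n W"
  obtains P where "psd n P" "P = W + F\<^sup>T * P * F"
proof -
  have cW: "W \<in> carrier_mat n n" using W by (simp add: psd_def)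
  define V where "V k = (F ^\<^sub>m k)\<^sup>T * W * F ^\<^sub>m k" for k
  have psdV: "psd n (V k)" for k unfolding V_def by (rule congruence_psd[OF _ W]) (use F in simp)
  then have cV: "V k \<in> carrier_mat n n" for k by (simp add: psd_def)
  have V0: "V 0 = W" using F cW by (simp add: V_def)
  have VS: "V (Suc k) = F\<^sup>T * V k * F" for k
  proof -
    have "F ^\<^sub>m k \<in> carrier_mat n n" using F by simp
    then show ?thesis unfolding V_def using F cW by (simp add: assoc_mult_dim transpose_mult_dim)
  qed
  obtain c r where cr: "0 \<le> c" "0 < r" "r < 1"
    "\<And>k i j. i < n \<Longrightarrow> j < n \<Longrightarrow> \<bar>(F ^\<^sub>m k) $$ (i, j)\<bar> \<le> c * r ^ k"
    using powers_decay_geometrically[OF F n sr] by blast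
  define P where "P = mat n n (\<lambda>(i, j). \<Sum>k. V k $$ (i, j))"
  have cP: "P \<in> carrier_mat n n" by (simp add: P_def)
  have sums: "(\<lambda>k. V k $$ (i, j)) sums P $$ (i, j)" if ij: "i < n" "j < n" for i j
  proof -
    let ?c = "\<Sum>a<n. \<Sum>b<n. c * \<bar>W $$ (a, b)\<bar> * c"
    have "r\<^sup>2 < 1" using cr by (simp add: power_less_one_iff)
    then have "summable (\<lambda>k. ?c * (r\<^sup>2) ^ k)"
      by (intro summable_mult summable_geometric) auto
    moreover have "norm (V k $$ (i, j)) \<le> ?c * (r\<^sup>2) ^ k" for k
      unfolding V_def real_norm_def by (rule congruence_power_bound[OF F cW cr(2,1) cr(4) ij])
    ultimately have "summable (\<lambda>k. V k $$ (i, j))"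
      by (rule summable_comparison_test'[where N = 0])
    then show ?thesis using ij by (simp add: P_def summable_sums)
  qed
  have "psd n P" unfolding psd_def
  proof (intro conjI ballI)
    show "P\<^sup>T = P"
    proof (rule eq_matI)
      fix i j assume "i < dim_row P" "j < dim_col P"
      then have ij: "i < n" "j < n" using cP by auto
      have "V k $$ (j, i) = V k $$ (i, j)" for k
      proof -
        have "(V k)\<^sup>T $$ (i, j) = V k $$ (i, j)" using psdV[of k] by (simp add: psd_def)
        then show ?thesis using ij cV[of k] by simp
      qed
      then have "(\<lambda>k. V k $$ (i, j)) sums P $$ (j, i)" using sums[of j i] ij by simp
      then have "P $$ (j, i) = P $$ (i, j)" by (rule sums_unique2[OF _ sums[OF ij]])
      then show "P\<^sup>T $$ (i, j) = P $$ (i, j)" using ij cP by simp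
    qed (use cP in auto)
    fix x :: "real Matrix.vec" assume x: "x \<in> carrier_vec n"
    have sx: "(\<lambda>k. x \<bullet> (V k *\<^sub>v x)) sums (x \<bullet> (P *\<^sub>v x))"
      unfolding quadform_sum[OF cV x] quadform_sum[OF cP x]
      by (intro sums_sum sums_mult sums_mult2 sums) auto
    have "0 \<le> x \<bullet> (V k *\<^sub>v x)" for k using psdV[of k] x by (simp add: psd_def)
    then show "0 \<le> x \<bullet> (P *\<^sub>v x)" by (rule sums_le[OF _ sums_zero sx])
  qed (rule cP)
  moreover have "P = W + F\<^sup>T * P * F"
  proof (rule eq_matI)
    fix i j assume "i < dim_row (W + F\<^sup>T * P * F)" "j < dim_col (W + F\<^sup>T * P * F)"
    then have ij: "i < n" "j < n" using F by auto
    have "(\<lambda>k. V (Suc k) $$ (i, j)) sums (F\<^sup>T * P * F) $$ (i, j)"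
      unfolding VS congruence_entry[OF F cV ij] congruence_entry[OF F cP ij]
      by (intro sums_sum sums_mult sums_mult2 sums) auto
    then have "(\<lambda>k. V k $$ (i, j)) sums ((F\<^sup>T * P * F) $$ (i, j) + V 0 $$ (i, j))"
      by (rule sums_Suc)
    then have "P $$ (i, j) = (F\<^sup>T * P * F) $$ (i, j) + W $$ (i, j)"
      using sums[OF ij] sums_unique2 V0 by metis
    then show "P $$ (i, j) = (W + F\<^sup>T * P * F) $$ (i, j)" using ij F cW by simp
  qed (use F cP in auto)
  ultimately show thesis by (rule that)
qed

section \<open>Second moments and quadratic forms\<close>

text \<open>
  A product of two coordinates is dominated by the sum of their squares.
\<close>

lemma integrable_coordinate_product:
  assumes "square_integrable_vec n \<Omega> x" "i < n" "j < n"
  shows "integrable \<Omega> (\<lambda>\<omega>. x \<omega> $ i * x \<omega> $ j)"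
proof -
  have m: "(\<lambda>\<omega>. x \<omega> $ i) \<in> borel_measurable \<Omega>" "(\<lambda>\<omega>. x \<omega> $ j) \<in> borel_measurable \<Omega>"
    and sq: "integrable \<Omega> (\<lambda>\<omega>. (x \<omega> $ i)\<^sup>2)" "integrable \<Omega> (\<lambda>\<omega>. (x \<omega> $ j)\<^sup>2)"
    using assms by (auto simp: square_integrable_vec_def)
  have b: "\<bar>a * b\<bar> \<le> a\<^sup>2 + b\<^sup>2" for a b :: real
    using sum_squares_bound[of "\<bar>a\<bar>" "\<bar>b\<bar>"] zero_le_power2[of a] zero_le_power2[of b]
    unfolding abs_mult power2_abs by linarith
  show ?thesis
  proof (rule Bochner_Integration.integrable_bound)
    show "integrable \<Omega> (\<lambda>\<omega>. (x \<omega> $ i)\<^sup>2 + (x \<omega> $ j)\<^sup>2)" using sq by simp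
    show "(\<lambda>\<omega>. x \<omega> $ i * x \<omega> $ j) \<in> borel_measurable \<Omega>" using m by simp
    show "AE \<omega> in \<Omega>. norm (x \<omega> $ i * x \<omega> $ j) \<le> norm ((x \<omega> $ i)\<^sup>2 + (x \<omega> $ j)\<^sup>2)"
      using b by (intro AE_I2) simp
  qed
qed

lemma expectation_bilinear:
  assumes x: "square_integrable_vec n \<Omega> x"
  shows "integrable \<Omega> (\<lambda>\<omega>. \<Sum>i<n. \<Sum>j<n. c i j * (x \<omega> $ i * x \<omega> $ j))"
    and "(\<integral>\<omega>. (\<Sum>i<n. \<Sum>j<n. c i j * (x \<omega> $ i * x \<omega> $ j)) \<partial>\<Omega>)
      = (\<Sum>i<n. \<Sum>j<n. c i j * second_moment n \<Omega> x $$ (i, j))"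
proof -
  have 1: "integrable \<Omega> (\<lambda>\<omega>. c i j * (x \<omega> $ i * x \<omega> $ j))" if "i < n" "j < n" for i j
    by (intro integrable_mult_right integrable_coordinate_product[OF x] that)
  then have 2: "integrable \<Omega> (\<lambda>\<omega>. \<Sum>j<n. c i j * (x \<omega> $ i * x \<omega> $ j))" if "i < n" for i
    by (intro Bochner_Integration.integrable_sum 1) (use that in auto)
  show "integrable \<Omega> (\<lambda>\<omega>. \<Sum>i<n. \<Sum>j<n. c i j * (x \<omega> $ i * x \<omega> $ j))"
    by (rule Bochner_Integration.integrable_sum, rule 2) simp
  have "(\<integral>\<omega>. (\<Sum>i<n. \<Sum>j<n. c i j * (x \<omega> $ i * x \<omega> $ j)) \<partial>\<Omega>)
      = (\<Sum>i<n. \<integral>\<omega>. (\<Sum>j<n. c i j * (x \<omega> $ i * x \<omega> $ j)) \<partial>\<Omega>)"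
    by (rule Bochner_Integration.integral_sum, rule 2) simp
  also have "\<dots> = (\<Sum>i<n. \<Sum>j<n. \<integral>\<omega>. c i j * (x \<omega> $ i * x \<omega> $ j) \<partial>\<Omega>)"
    by (intro sum.cong refl Bochner_Integration.integral_sum, rule 1) auto
  also have "\<dots> = (\<Sum>i<n. \<Sum>j<n. c i j * second_moment n \<Omega> x $$ (i, j))"
    by (simp add: second_moment_def)
  finally show "(\<integral>\<omega>. (\<Sum>i<n. \<Sum>j<n. c i j * (x \<omega> $ i * x \<omega> $ j)) \<partial>\<Omega>)
      = (\<Sum>i<n. \<Sum>j<n. c i j * second_moment n \<Omega> x $$ (i, j))" .
qed

lemma second_moment_symmetric: "(second_moment n \<Omega> x)\<^sup>T = second_moment n \<Omega> x"
  by (rule eq_matI) (auto simp: second_moment_def mult.commute)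

lemma second_moment_linear_image:
  assumes x: "square_integrable_vec n \<Omega> x" and T: "T \<in> carrier_mat n n"
  shows "second_moment n \<Omega> (\<lambda>\<omega>. T *\<^sub>v x \<omega>) = T * second_moment n \<Omega> x * T\<^sup>T"
proof (rule eq_matI)
  let ?S = "second_moment n \<Omega> x"
  have S: "?S \<in> carrier_mat n n" by (simp add: second_moment_def)
  fix i j assume "i < dim_row (T * ?S * T\<^sup>T)" "j < dim_col (T * ?S * T\<^sup>T)"
  then have ij: "i < n" "j < n" using T by auto
  have e: "(T *\<^sub>v x \<omega>) $ i * (T *\<^sub>v x \<omega>) $ j
      = (\<Sum>a<n. \<Sum>b<n. T $$ (i, a) * T $$ (j, b) * (x \<omega> $ a * x \<omega> $ b))" if "\<omega> \<in> space \<Omega>" for \<omega>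
  proof -
    have "x \<omega> \<in> carrier_vec n" using x that by (auto simp: square_integrable_vec_def)
    then have "(T *\<^sub>v x \<omega>) $ i * (T *\<^sub>v x \<omega>) $ j
        = (\<Sum>a<n. T $$ (i, a) * x \<omega> $ a) * (\<Sum>b<n. T $$ (j, b) * x \<omega> $ b)"
      using T ij by (simp add: scalar_prod_def atLeast0LessThan)
    also have "\<dots> = (\<Sum>a<n. \<Sum>b<n. (T $$ (i, a) * x \<omega> $ a) * (T $$ (j, b) * x \<omega> $ b))"
      by (rule sum_product)
    finally show ?thesis by (simp add: mult_ac)
  qed
  have "second_moment n \<Omega> (\<lambda>\<omega>. T *\<^sub>v x \<omega>) $$ (i, j)
      = (\<integral>\<omega>. (\<Sum>a<n. \<Sum>b<n. T $$ (i, a) * T $$ (j, b) * (x \<omega> $ a * x \<omega> $ b)) \<partial>\<Omega>)"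
    using ij e by (simp add: second_moment_def cong: Bochner_Integration.integral_cong)
  also have "\<dots> = (\<Sum>a<n. \<Sum>b<n. T $$ (i, a) * T $$ (j, b) * ?S $$ (a, b))"
    by (rule expectation_bilinear(2)[OF x])
  also have "\<dots> = (\<Sum>a<n. \<Sum>b<n. T\<^sup>T $$ (a, i) * ?S $$ (a, b) * T\<^sup>T $$ (b, j))"
    using T ij by (intro sum.cong) auto
  also have "\<dots> = (T\<^sup>T\<^sup>T * ?S * T\<^sup>T) $$ (i, j)"
    by (rule congruence_entry[symmetric, OF _ S ij]) (use T in auto)
  finally show "second_moment n \<Omega> (\<lambda>\<omega>. T *\<^sub>v x \<omega>) $$ (i, j) = (T * ?S * T\<^sup>T) $$ (i, j)" by simp
qed (use T in \<open>auto simp: second_moment_def\<close>)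

text \<open>
  This turns the trace that defines the cost into an expectation, where positivity can be read off
  pointwise.
\<close>

lemma expectation_quadform:
  assumes x: "square_integrable_vec n \<Omega> x" and D: "D \<in> carrier_mat n n"
  shows "integrable \<Omega> (\<lambda>\<omega>. x \<omega> \<bullet> (D *\<^sub>v x \<omega>))" (is ?i)
    and "(\<integral>\<omega>. x \<omega> \<bullet> (D *\<^sub>v x \<omega>) \<partial>\<Omega>) = mtrace (D * second_moment n \<Omega> x)" (is ?e)
proof -
  have q: "x \<omega> \<bullet> (D *\<^sub>v x \<omega>) = (\<Sum>i<n. \<Sum>j<n. D $$ (i, j) * (x \<omega> $ i * x \<omega> $ j))"
    if "\<omega> \<in> space \<Omega>" for \<omega>
    using x that quadform_sum[OF D, of "x \<omega>"] by (simp add: square_integrable_vec_def mult_ac)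
  show ?i using q expectation_bilinear(1)[OF x]
    by (simp cong: Bochner_Integration.integrable_cong)
  have "(\<integral>\<omega>. x \<omega> \<bullet> (D *\<^sub>v x \<omega>) \<partial>\<Omega>)
      = (\<Sum>i<n. \<Sum>j<n. D $$ (i, j) * second_moment n \<Omega> x $$ (i, j))"
    using q by (simp add: expectation_bilinear(2)[OF x] cong: Bochner_Integration.integral_cong)
  also have "\<dots> = (\<Sum>i<n. \<Sum>j<n. D $$ (i, j) * (second_moment n \<Omega> x)\<^sup>T $$ (i, j))"
    unfolding second_moment_symmetric ..
  also have "\<dots> = mtrace (D * second_moment n \<Omega> x)"
    using D by (simp add: mtrace_def scalar_prod_def atLeast0LessThan second_moment_def)
  finally show ?e .
qed

text \<open>
  A semidefinite form takes its minimum zero at \<open>x\<close>, so moving from \<open>x\<close> along its gradient \<open>y = D x\<close>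
  cannot lower it. The value at \<open>x + t y\<close> is \<open>2 t (y \<bullet> y) + t\<^sup>2 (y \<bullet> D y)\<close>, which is negative for small
  negative \<open>t\<close> unless \<open>y = 0\<close>.
\<close>

lemma psd_quadform_zero:
  assumes D: "psd n D" and x: "x \<in> carrier_vec n" and z: "x \<bullet> (D *\<^sub>v x) = 0"
  shows "D *\<^sub>v x = 0\<^sub>v n"
proof -
  have cD: "D \<in> carrier_mat n n" and tD: "D\<^sup>T = D" using D by (auto simp: psd_def)
  define y where "y = D *\<^sub>v x"
  have y: "y \<in> carrier_vec n" using cD x by (simp add: y_def)
  have Dy: "D *\<^sub>v y \<in> carrier_vec n" using cD y by simp
  define a where "a = y \<bullet> y"
  define b where "b = y \<bullet> (D *\<^sub>v y)"
  have b0: "0 \<le> b" using D y by (simp add: psd_def b_def)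
  have xDy: "x \<bullet> (D *\<^sub>v y) = a"
    using scalar_prod_transpose[of x D y] cD x y tD by (simp add: a_def y_def)
  have *: "0 \<le> 2 * t * a + t * t * b" for t
  proof -
    have ty: "t \<cdot>\<^sub>v y \<in> carrier_vec n" using y by simp
    have "D *\<^sub>v (x + t \<cdot>\<^sub>v y) = y + t \<cdot>\<^sub>v (D *\<^sub>v y)"
      using cD x y ty by (simp add: mult_add_distrib_mat_vec[OF cD x ty] mult_mat_vec y_def[symmetric])
    then have "(x + t \<cdot>\<^sub>v y) \<bullet> (D *\<^sub>v (x + t \<cdot>\<^sub>v y))
        = x \<bullet> y + t * (x \<bullet> (D *\<^sub>v y)) + (t * (y \<bullet> y) + t * (t * (y \<bullet> (D *\<^sub>v y))))"
      using x y Dy by (simp add: add_scalar_prod_distrib[of _ n] scalar_prod_add_distrib[of _ n] algebra_simps)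
    also have "x \<bullet> y = 0" using z by (simp add: y_def)
    finally have "(x + t \<cdot>\<^sub>v y) \<bullet> (D *\<^sub>v (x + t \<cdot>\<^sub>v y)) = 2 * t * a + t * t * b"
      by (simp add: xDy a_def[symmetric] b_def[symmetric])
    moreover have "0 \<le> (x + t \<cdot>\<^sub>v y) \<bullet> (D *\<^sub>v (x + t \<cdot>\<^sub>v y))" using D x ty by (simp add: psd_def)
    ultimately show ?thesis by simp
  qed
  have "a \<ge> 0" using y by (auto simp: a_def scalar_prod_def intro!: sum_nonneg)
  moreover have "\<not> 0 < a"
  proof
    assume a: "0 < a"
    \<comment> \<open>The summand 1 keeps the denominator positive when \<open>b = 0\<close>.\<close>
    define t where "t = - a / (b + 1)"
    have tb: "t * (b + 1) = - a" using b0 by (simp add: t_def)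
    have t: "t < 0" using a b0 by (simp add: t_def divide_neg_pos)
    have tb': "t * b = - a - t" using tb by (simp add: algebra_simps)
    have "2 * t * a + t * t * b = 2 * t * a + t * (t * b)" by simp
    also have "\<dots> = t * (a - t)" unfolding tb' by (simp add: algebra_simps)
    also have "\<dots> < 0" using a t by (intro mult_neg_pos) auto
    finally show False using *[of t] by simp
  qed
  ultimately have "y \<bullet> y = 0" by (simp add: a_def)
  then show ?thesis using scalar_prod_self_zero[OF y] by (simp add: y_def)
qed

text \<open>
  The trace is the expectation of \<open>x \<bullet> D x \<ge> 0\<close>. If it vanishes, then \<open>D x = 0\<close> almost surely, so every
  \<open>w = D v\<close> is almost surely orthogonal to \<open>x\<close>. The second moment of \<open>x\<close> in the direction \<open>w\<close> is then
  zero, and definiteness of the second-moment matrix forces \<open>w = 0\<close>.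
\<close>

lemma trace_psd_second_moment:
  assumes x: "square_integrable_vec n \<Omega> x" and D: "psd n D"
    and S: "pd n (second_moment n \<Omega> x)"
  shows "0 \<le> mtrace (D * second_moment n \<Omega> x)" (is ?nonneg)
    and "mtrace (D * second_moment n \<Omega> x) = 0 \<Longrightarrow> D = 0\<^sub>m n n"
proof -
  have cD: "D \<in> carrier_mat n n" and tD: "D\<^sup>T = D" using D by (auto simp: psd_def)
  have xc: "x \<omega> \<in> carrier_vec n" if "\<omega> \<in> space \<Omega>" for \<omega>
    using x that by (simp add: square_integrable_vec_def)
  have nn: "AE \<omega> in \<Omega>. 0 \<le> x \<omega> \<bullet> (D *\<^sub>v x \<omega>)"
    using D xc by (intro AE_I2) (simp add: psd_def)
  show ?nonneg
    unfolding expectation_quadform(2)[OF x cD, symmetric] by (rule integral_nonneg_AE[OF nn])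
  assume "mtrace (D * second_moment n \<Omega> x) = 0"
  then have "AE \<omega> in \<Omega>. x \<omega> \<bullet> (D *\<^sub>v x \<omega>) = 0"
    using integral_nonneg_eq_0_iff_AE[OF expectation_quadform(1)[OF x cD] nn]
    by (simp add: expectation_quadform(2)[OF x cD])
  then have ker: "AE \<omega> in \<Omega>. D *\<^sub>v x \<omega> = 0\<^sub>v n"
    using AE_space by eventually_elim (rule psd_quadform_zero[OF D xc])
  have Dv: "D *\<^sub>v v = 0\<^sub>v n" if v: "v \<in> carrier_vec n" for v
  proof -
    define w where "w = D *\<^sub>v v"
    have w: "w \<in> carrier_vec n" using cD v by (simp add: w_def)
    \<comment> \<open>\<open>W\<close> is the matrix \<open>w w\<^sup>T\<close>, whose quadratic form is \<open>(w \<bullet> x)\<^sup>2\<close>.\<close>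
    define W where "W = mat n n (\<lambda>(i, j). w $ i * w $ j)"
    have cW: "W \<in> carrier_mat n n" by (simp add: W_def)
    have sq: "x \<omega> \<bullet> (W *\<^sub>v x \<omega>) = (w \<bullet> x \<omega>) * (w \<bullet> x \<omega>)" if "\<omega> \<in> space \<Omega>" for \<omega>
      using xc[OF that] w quadform_sum[OF cW xc[OF that]]
      by (simp add: W_def scalar_prod_def atLeast0LessThan sum_product mult_ac)
    have "AE \<omega> in \<Omega>. x \<omega> \<bullet> (W *\<^sub>v x \<omega>) = 0"
      using ker AE_space
    proof eventually_elim
      case (elim \<omega>)
      have "w \<bullet> x \<omega> = v \<bullet> (D *\<^sub>v x \<omega>)"
        using scalar_prod_transpose[of v D "x \<omega>"] cD v xc[OF elim(2)] tD by (simp add: w_def)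
      then show ?case using elim sq v by simp
    qed
    then have "(\<integral>\<omega>. x \<omega> \<bullet> (W *\<^sub>v x \<omega>) \<partial>\<Omega>) = 0" by (rule integral_eq_zero_AE)
    then have "mtrace (W * second_moment n \<Omega> x) = 0" using expectation_quadform(2)[OF x cW] by simp
    also have "mtrace (W * second_moment n \<Omega> x) = w \<bullet> (second_moment n \<Omega> x *\<^sub>v w)"
    proof -
      have cS: "second_moment n \<Omega> x \<in> carrier_mat n n" by (simp add: second_moment_def)
      have "mtrace (W * second_moment n \<Omega> x) = (\<Sum>i<n. \<Sum>j<n. w $ i * w $ j * second_moment n \<Omega> x $$ (j, i))"
        using cS by (simp add: mtrace_def scalar_prod_def atLeast0LessThan W_def)
      also have "\<dots> = (\<Sum>j<n. \<Sum>i<n. w $ i * w $ j * second_moment n \<Omega> x $$ (j, i))"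
        by (rule sum.swap)
      also have "\<dots> = w \<bullet> (second_moment n \<Omega> x *\<^sub>v w)"
        unfolding quadform_sum[OF cS w] by (simp add: mult_ac)
      finally show ?thesis .
    qed
    finally show ?thesis using S w unfolding pd_def w_def by force
  qed
  show "D = 0\<^sub>m n n"
  proof (rule eq_matI)
    fix i j assume ij: "i < dim_row (0\<^sub>m n n :: real mat)" "j < dim_col (0\<^sub>m n n :: real mat)"
    then have "D $$ (i, j) = (D *\<^sub>v unit_vec n j) $ i" using cD by (simp add: scalar_prod_right_unit)
    also have "\<dots> = 0" using Dv[of "unit_vec n j"] ij by simp
    finally show "D $$ (i, j) = 0\<^sub>m n n $$ (i, j)" using ij by simp
  qed (use cD in auto)
qed

section \<open>State reconstruction from inputs and outputs\<close>

lemma obsv_mat_carrier: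
  assumes "C \<in> carrier_mat d n" shows "obsv_mat k C A \<in> carrier_mat (k * d) n"
  using assms by (auto simp: obsv_mat_def Let_def)

lemma ctrb_mat_carrier:
  assumes "B \<in> carrier_mat n m" shows "ctrb_mat k A B \<in> carrier_mat n (k * m)"
  using assms by (auto simp: ctrb_mat_def Let_def)

lemma toeplitz_mat_carrier:
  assumes "B \<in> carrier_mat n m" "C \<in> carrier_mat d n"
  shows "toeplitz_mat k A B C \<in> carrier_mat (k * d) (k * m)"
  using assms by (auto simp: toeplitz_mat_def Let_def)

lemma row_obsv_mat:
  assumes A: "A \<in> carrier_mat n n" and C: "C \<in> carrier_mat d n" and i: "i < k * d"
  shows "row (obsv_mat k C A) i = row (C * A ^\<^sub>m (k - 1 - i div d)) (i mod d)"
proof -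
  have "0 < d" using i by (cases d) auto
  then have md: "i mod d < d" by simp
  have Ak: "A ^\<^sub>m (k - 1 - i div d) \<in> carrier_mat n n" using A by (rule pow_carrier_mat)
  show ?thesis
    using C i md carrier_matD[OF Ak]
    by (intro eq_vecI) (auto simp: obsv_mat_def Let_def simp del: index_mult_mat(1))
qed

lemma col_ctrb_mat:
  assumes A: "A \<in> carrier_mat n n" and B: "B \<in> carrier_mat n m" and j: "j < k * m"
  shows "col (ctrb_mat k A B) j = col (A ^\<^sub>m (j div m) * B) (j mod m)"
proof -
  have "0 < m" using j by (cases m) auto
  then have mm: "j mod m < m" by simp
  have Ak: "A ^\<^sub>m (j div m) \<in> carrier_mat n n" using A by (rule pow_carrier_mat)
  show ?thesis
    using B j mm carrier_matD[OF Ak]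
    by (intro eq_vecI) (auto simp: ctrb_mat_def Let_def simp del: index_mult_mat(1))
qed

lemma block_index_less: "i < (k :: nat) \<Longrightarrow> l < d \<Longrightarrow> i * d + l < k * d"
  by (metis add.commute add_less_cancel_left less_le_trans mult.commute mult_Suc_right mult_le_mono2 Suc_leI)

text \<open>
  Block by block, the kernel of the observability matrix consists of the states that produce zero
  output during the first \<open>k\<close> steps. In this form it is visibly decreasing in \<open>k\<close>.
\<close>

lemma obsv_mat_kernel_iff:
  assumes A: "A \<in> carrier_mat n n" and C: "C \<in> carrier_mat d n" and v: "v \<in> carrier_vec n"
  shows "obsv_mat k C A *\<^sub>v v = 0\<^sub>v (k * d) \<longleftrightarrow> (\<forall>i<k. C * A ^\<^sub>m i *\<^sub>v v = 0\<^sub>v d)"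
proof
  assume z: "obsv_mat k C A *\<^sub>v v = 0\<^sub>v (k * d)"
  show "\<forall>i<k. C * A ^\<^sub>m i *\<^sub>v v = 0\<^sub>v d"
  proof (intro allI impI eq_vecI)
    fix i l assume i: "i < k" and "l < dim_vec (0\<^sub>v d :: real Matrix.vec)"
    then have l: "l < d" by simp
    \<comment> \<open>The block rows are listed with decreasing powers of \<open>A\<close>.\<close>
    define j where "j = (k - 1 - i) * d + l"
    have j: "j < k * d" unfolding j_def using i l by (intro block_index_less) auto
    have jd: "k - 1 - j div d = i" "j mod d = l" using i l by (auto simp: j_def)
    have "(C * A ^\<^sub>m i *\<^sub>v v) $ l = row (obsv_mat k C A) j \<bullet> v"
      unfolding row_obsv_mat[OF A C j] jd using l C by simp
    also have "\<dots> = (obsv_mat k C A *\<^sub>v v) $ j" using j obsv_mat_carrier[OF C, of k A] by simp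
    finally show "(C * A ^\<^sub>m i *\<^sub>v v) $ l = 0\<^sub>v d $ l" using z j l by simp
  qed (use C in auto)
next
  assume z: "\<forall>i<k. C * A ^\<^sub>m i *\<^sub>v v = 0\<^sub>v d"
  show "obsv_mat k C A *\<^sub>v v = 0\<^sub>v (k * d)"
  proof (rule eq_vecI)
    fix j assume "j < dim_vec (0\<^sub>v (k * d) :: real Matrix.vec)"
    then have j: "j < k * d" by simp
    then have d: "0 < d" and k: "0 < k" by (cases d; cases k; auto)+
    have "(obsv_mat k C A *\<^sub>v v) $ j = row (obsv_mat k C A) j \<bullet> v"
      using j obsv_mat_carrier[OF C, of k A] by simp
    also have "\<dots> = (C * A ^\<^sub>m (k - 1 - j div d) *\<^sub>v v) $ (j mod d)"
      unfolding row_obsv_mat[OF A C j] using d C by simp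
    also have "\<dots> = 0" using z[rule_format, of "k - 1 - j div d"] k d by simp
    finally show "(obsv_mat k C A *\<^sub>v v) $ j = 0\<^sub>v (k * d) $ j" using j by simp
  qed (use obsv_mat_carrier[OF C, of k A] in auto)
qed

text \<open>
  The vectors in question are the linear functionals that vanish on all states reachable from the
  origin in \<open>k\<close> steps.
\<close>

lemma ctrb_mat_kernel_iff:
  assumes A: "A \<in> carrier_mat n n" and B: "B \<in> carrier_mat n m" and v: "v \<in> carrier_vec n"
  shows "(ctrb_mat k A B)\<^sup>T *\<^sub>v v = 0\<^sub>v (k * m) \<longleftrightarrow> (\<forall>i<k. (A ^\<^sub>m i * B)\<^sup>T *\<^sub>v v = 0\<^sub>v m)"
proof
  assume z: "(ctrb_mat k A B)\<^sup>T *\<^sub>v v = 0\<^sub>v (k * m)"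
  show "\<forall>i<k. (A ^\<^sub>m i * B)\<^sup>T *\<^sub>v v = 0\<^sub>v m"
  proof (intro allI impI eq_vecI)
    fix i l assume i: "i < k" and "l < dim_vec (0\<^sub>v m :: real Matrix.vec)"
    then have l: "l < m" by simp
    define j where "j = i * m + l"
    have j: "j < k * m" unfolding j_def using i l by (intro block_index_less) auto
    have jd: "j div m = i" "j mod m = l" using l by (auto simp: j_def)
    have "((A ^\<^sub>m i * B)\<^sup>T *\<^sub>v v) $ l = col (ctrb_mat k A B) j \<bullet> v"
      unfolding col_ctrb_mat[OF A B j] jd using l B by simp
    also have "\<dots> = ((ctrb_mat k A B)\<^sup>T *\<^sub>v v) $ j" using j ctrb_mat_carrier[OF B, of k A] by simp
    finally show "((A ^\<^sub>m i * B)\<^sup>T *\<^sub>v v) $ l = 0\<^sub>v m $ l" using z j l by simp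
  qed (use B in auto)
next
  assume z: "\<forall>i<k. (A ^\<^sub>m i * B)\<^sup>T *\<^sub>v v = 0\<^sub>v m"
  show "(ctrb_mat k A B)\<^sup>T *\<^sub>v v = 0\<^sub>v (k * m)"
  proof (rule eq_vecI)
    fix j assume "j < dim_vec (0\<^sub>v (k * m) :: real Matrix.vec)"
    then have j: "j < k * m" by simp
    then have m: "0 < m" by (cases m) auto
    have jk: "j div m < k" using j by (simp add: less_mult_imp_div_less)
    have "((ctrb_mat k A B)\<^sup>T *\<^sub>v v) $ j = col (ctrb_mat k A B) j \<bullet> v"
      using j ctrb_mat_carrier[OF B, of k A] by simp
    also have "\<dots> = ((A ^\<^sub>m (j div m) * B)\<^sup>T *\<^sub>v v) $ (j mod m)"
      unfolding col_ctrb_mat[OF A B j] using m B by simp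
    also have "\<dots> = 0" using z jk m by simp
    finally show "((ctrb_mat k A B)\<^sup>T *\<^sub>v v) $ j = 0\<^sub>v (k * m) $ j" using j by simp
  qed (use ctrb_mat_carrier[OF B, of k A] in auto)
qed

text \<open>
  At the observability index the kernel is already trivial, and it only shrinks when further block
  rows are added.
\<close>

lemma obsv_mat_kernel_trivial:
  assumes A: "A \<in> carrier_mat n n" and C: "C \<in> carrier_mat d n" and ob: "observable C A"
    and p: "obsv_index C A \<le> p" and v: "v \<in> carrier_vec n" "obsv_mat p C A *\<^sub>v v = 0\<^sub>v (p * d)"
  shows "v = 0\<^sub>v n"
proof -
  let ?k = "obsv_index C A"
  have "vec_space.rank (?k * d) (obsv_mat ?k C A) = n"
    using ob A C unfolding observable_def obsv_index_def
    using LeastI[of "\<lambda>k. vec_space.rank (k * dim_row C) (obsv_mat k C A) = dim_row A" "dim_row A"] by auto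
  moreover have "obsv_mat ?k C A *\<^sub>v v = 0\<^sub>v (?k * d)"
    using v p by (auto simp: obsv_mat_kernel_iff[OF A C])
  ultimately show ?thesis using full_col_rank_kernel[OF obsv_mat_carrier[OF C]] v(1) by blast
qed

lemma ctrb_mat_kernel_trivial:
  assumes A: "A \<in> carrier_mat n n" and B: "B \<in> carrier_mat n m" and co: "controllable A B"
    and p: "ctrb_index A B \<le> p" and v: "v \<in> carrier_vec n" "(ctrb_mat p A B)\<^sup>T *\<^sub>v v = 0\<^sub>v (p * m)"
  shows "v = 0\<^sub>v n"
proof -
  let ?k = "ctrb_index A B"
  have "vec_space.rank n (ctrb_mat ?k A B) = n"
    using co A B unfolding controllable_def ctrb_index_def
    using LeastI[of "\<lambda>k. vec_space.rank (dim_row A) (ctrb_mat k A B) = dim_row A" "dim_row A"] by auto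
  moreover have "(ctrb_mat ?k A B)\<^sup>T *\<^sub>v v = 0\<^sub>v (?k * m)"
    using v p by (auto simp: ctrb_mat_kernel_iff[OF A B])
  ultimately show ?thesis using full_row_rank_kernel[OF ctrb_mat_carrier[OF B]] v(1) by blast
qed

lemma hcat_carrier:
  "X \<in> carrier_mat k a \<Longrightarrow> Y \<in> carrier_mat k b \<Longrightarrow> hcat X Y \<in> carrier_mat k (a + b)"
  by (auto simp: hcat_def)

lemma col_hcat:
  assumes "X \<in> carrier_mat k a" "Y \<in> carrier_mat k b" "j < a + b"
  shows "col (hcat X Y) j = (if j < a then col X j else col Y (j - a))"
  by (rule eq_vecI) (use assms in \<open>auto simp: hcat_def\<close>)

lemma mult_hcat:
  assumes T: "T \<in> carrier_mat l k" and X: "X \<in> carrier_mat k a" and Y: "Y \<in> carrier_mat k b"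
  shows "T * hcat X Y = hcat (T * X) (T * Y)"
proof (rule eq_matI)
  have h: "hcat X Y \<in> carrier_mat k (a + b)" by (rule hcat_carrier[OF X Y])
  have h': "hcat (T * X) (T * Y) \<in> carrier_mat l (a + b)"
    by (rule hcat_carrier) (use T X Y in auto)
  fix i j assume "i < dim_row (hcat (T * X) (T * Y))" "j < dim_col (hcat (T * X) (T * Y))"
  then have ij: "i < l" "j < a + b" using h' by auto
  have "(T * hcat X Y) $$ (i, j) = row T i \<bullet> col (hcat X Y) j" using ij T h by simp
  also have "\<dots> = col (hcat (T * X) (T * Y)) j $ i"
    using ij T X Y by (auto simp: col_hcat[OF X Y] col_hcat[of "T * X" l a "T * Y" b])
  finally show "(T * hcat X Y) $$ (i, j) = hcat (T * X) (T * Y) $$ (i, j)" using ij h' by simp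
qed (use hcat_carrier[OF X Y] hcat_carrier[of "T * X" l a "T * Y" b] T X Y in auto)

lemma hcat_transpose_kernel:
  assumes X: "X \<in> carrier_mat k a" and Y: "Y \<in> carrier_mat k b" and v: "v \<in> carrier_vec k"
    and z: "(hcat X Y)\<^sup>T *\<^sub>v v = 0\<^sub>v (a + b)"
  shows "X\<^sup>T *\<^sub>v v = 0\<^sub>v a" "Y\<^sup>T *\<^sub>v v = 0\<^sub>v b"
proof -
  have h: "hcat X Y \<in> carrier_mat k (a + b)" by (rule hcat_carrier[OF X Y])
  have *: "col (hcat X Y) j \<bullet> v = 0" if "j < a + b" for j
  proof -
    have "col (hcat X Y) j \<bullet> v = ((hcat X Y)\<^sup>T *\<^sub>v v) $ j" using h that by simp
    then show ?thesis using z that by simp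
  qed
  show "X\<^sup>T *\<^sub>v v = 0\<^sub>v a"
  proof (rule eq_vecI)
    fix j assume "j < dim_vec (0\<^sub>v a :: real Matrix.vec)"
    then show "(X\<^sup>T *\<^sub>v v) $ j = 0\<^sub>v a $ j" using *[of j] X by (simp add: col_hcat[OF X Y])
  qed (use X in auto)
  show "Y\<^sup>T *\<^sub>v v = 0\<^sub>v b"
  proof (rule eq_vecI)
    fix j assume "j < dim_vec (0\<^sub>v b :: real Matrix.vec)"
    then show "(Y\<^sup>T *\<^sub>v v) $ j = 0\<^sub>v b $ j" using *[of "a + j"] Y by (simp add: col_hcat[OF X Y])
  qed (use Y in auto)
qed

text \<open>
  The rank conditions on the observability and controllability matrices are used only as statements
  about kernels, for the common number \<open>p\<close> of blocks.
\<close>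

locale observed_system =
  fixes n m d p :: nat and A B C :: "real mat"
  assumes n_pos: "0 < n"
    and A: "A \<in> carrier_mat n n" and B: "B \<in> carrier_mat n m" and C: "C \<in> carrier_mat d n"
    and obsv_kernel: "\<And>v. v \<in> carrier_vec n \<Longrightarrow> obsv_mat p C A *\<^sub>v v = 0\<^sub>v (p * d) \<Longrightarrow> v = 0\<^sub>v n"
    and ctrb_kernel: "\<And>v. v \<in> carrier_vec n \<Longrightarrow> (ctrb_mat p A B)\<^sup>T *\<^sub>v v = 0\<^sub>v (p * m) \<Longrightarrow> v = 0\<^sub>v n"
begin

abbreviation "Obs \<equiv> obsv_mat p C A"
abbreviation "Ctr \<equiv> ctrb_mat p A B"
abbreviation "Toep \<equiv> toeplitz_mat p A B C"
abbreviation "S \<equiv> S_mat p A B C"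
abbreviation "Sp \<equiv> S_pinv p A B C"
abbreviation "q \<equiv> p * (m + d)"
abbreviation "F K \<equiv> closed_loop p A B C K"

lemmas Obs = obsv_mat_carrier[OF C, of p A]
lemmas Ctr = ctrb_mat_carrier[OF B, of p A]
lemmas Toep = toeplitz_mat_carrier[OF B C, of p A]

lemma Obs_gram_inverse:
  shows "minv (Obs\<^sup>T * Obs) \<in> carrier_mat n n"
    and "(Obs\<^sup>T * Obs) * minv (Obs\<^sup>T * Obs) = 1\<^sub>m n"
  using minv_inverts[of "Obs\<^sup>T * Obs" n] gram_det_nonzero[OF Obs obsv_kernel] Obs by auto

lemma left_pinv_Obs: "left_pinv Obs \<in> carrier_mat n (p * d)"
  using Obs_gram_inverse(1) Obs by (auto simp: left_pinv_def)

lemma S_blocks: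
  shows "Ctr - A ^\<^sub>m p * left_pinv Obs * Toep \<in> carrier_mat n (p * m)"
    and "A ^\<^sub>m p * left_pinv Obs \<in> carrier_mat n (p * d)"
  using left_pinv_Obs Ctr Toep pow_carrier_mat[OF A, of p] by (auto intro!: minus_carrier_mat mult_carrier_mat)

lemma S: "S \<in> carrier_mat n q"
  using hcat_carrier[OF S_blocks] by (simp add: S_mat_def algebra_simps)

text \<open>
  Full row rank of \<open>S = [Ctr - Y Toep, Y]\<close>, where \<open>Y = A\<^sup>p Obs\<^sup>\<dagger>\<close>: a vector orthogonal to all columns of \<open>S\<close>
  is orthogonal to those of \<open>Y\<close>, hence to those of \<open>Y Toep\<close>, hence to those of \<open>Ctr\<close>, and the left
  kernel of \<open>Ctr\<close> is trivial.
\<close>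

lemma S_transpose_kernel:
  assumes v: "v \<in> carrier_vec n" and z: "S\<^sup>T *\<^sub>v v = 0\<^sub>v q"
  shows "v = 0\<^sub>v n"
proof -
  let ?Y = "A ^\<^sub>m p * left_pinv Obs"
  note Y = S_blocks(2)
  have z': "(hcat (Ctr - ?Y * Toep) ?Y)\<^sup>T *\<^sub>v v = 0\<^sub>v (p * m + p * d)"
    using z by (simp add: S_mat_def algebra_simps)
  note k = hcat_transpose_kernel[OF S_blocks v z']
  have YT: "?Y * Toep \<in> carrier_mat n (p * m)" using Y Toep by (rule mult_carrier_mat)
  have "(?Y * Toep)\<^sup>T *\<^sub>v v = Toep\<^sup>T *\<^sub>v (?Y\<^sup>T *\<^sub>v v)"
    using transpose_mult[OF Y Toep] Y Toep v by (simp add: mult_mat_vec_dim)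
  also have "\<dots> = 0\<^sub>v (p * m)"
    unfolding k(2) using Toep by (intro eq_vecI) auto
  finally have "(?Y * Toep)\<^sup>T *\<^sub>v v = 0\<^sub>v (p * m)" .
  moreover have "Ctr\<^sup>T = (Ctr - ?Y * Toep)\<^sup>T + (?Y * Toep)\<^sup>T"
    using Ctr YT by (intro eq_matI) (simp_all del: index_mult_mat(1) index_mult_mat(2) index_mult_mat(3))
  then have "Ctr\<^sup>T *\<^sub>v v = (Ctr - ?Y * Toep)\<^sup>T *\<^sub>v v + (?Y * Toep)\<^sup>T *\<^sub>v v"
    using add_mult_distrib_mat_vec[of "(Ctr - ?Y * Toep)\<^sup>T" "p * m" n "(?Y * Toep)\<^sup>T" v] S_blocks(1) YT v
    by simp
  ultimately have "Ctr\<^sup>T *\<^sub>v v = 0\<^sub>v (p * m)" using k(1) by simp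
  then show ?thesis using ctrb_kernel v by blast
qed

lemma S_gram_inverse:
  shows "minv (S * S\<^sup>T) \<in> carrier_mat n n"
    and "(S * S\<^sup>T) * minv (S * S\<^sup>T) = 1\<^sub>m n"
proof -
  have ST: "S\<^sup>T \<in> carrier_mat q n" using S by simp
  have det: "det (S * S\<^sup>T) \<noteq> 0" using gram_det_nonzero[OF ST S_transpose_kernel] by simp
  have SS: "S * S\<^sup>T \<in> carrier_mat n n" using S ST by (rule mult_carrier_mat)
  show "minv (S * S\<^sup>T) \<in> carrier_mat n n" and "(S * S\<^sup>T) * minv (S * S\<^sup>T) = 1\<^sub>m n"
    by (rule minv_inverts[OF SS det])+
qed

lemma Sp: "Sp \<in> carrier_mat q n"
  using S S_gram_inverse(1) by (auto simp: S_pinv_def right_pinv_def)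

lemma S_Sp: "S * Sp = 1\<^sub>m n"
proof -
  have ST: "S\<^sup>T \<in> carrier_mat q n" using S by simp
  have "S * Sp = S * S\<^sup>T * minv (S * S\<^sup>T)"
    unfolding S_pinv_def right_pinv_def by (rule assoc_mult_mat[OF S ST S_gram_inverse(1), symmetric])
  then show ?thesis using S_gram_inverse(2) by simp
qed

lemma closed_loop_carrier: "K \<in> carrier_mat m q \<Longrightarrow> F K \<in> carrier_mat n n"
  using A B Sp by (auto simp: closed_loop_def intro!: minus_carrier_mat)

lemma closed_loop_eq: "K \<in> carrier_mat m q \<Longrightarrow> F K = A - B * (K * Sp)"
  using assoc_mult_mat[OF B _ Sp] by (simp add: closed_loop_def)

lemma feasible_iff:
  "K \<in> feasible p A B C \<longleftrightarrow>
    K \<in> carrier_mat m q \<and> spectral_radius (map_mat complex_of_real (F K)) < 1"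
  using B C by (simp add: feasible_def)

text \<open>
  The value equation depends on \<open>K\<close> only through the state feedback \<open>K S\<^sup>\<dagger>\<close>.
\<close>

lemma stage_cost_regroup:
  assumes K: "K \<in> carrier_mat m q" and R: "R \<in> carrier_mat m m"
  shows "Sp\<^sup>T * K\<^sup>T * R * K * Sp = (K * Sp)\<^sup>T * R * (K * Sp)"
  using carrier_matD[OF K] carrier_matD[OF Sp] carrier_matD[OF R] by (simp add: mat_distribs)

lemma stage_cost_psd:
  assumes K: "K \<in> carrier_mat m q" and Q: "psd d Q" and R: "psd m R"
  shows "psd n (C\<^sup>T * Q * C + Sp\<^sup>T * K\<^sup>T * R * K * Sp)"
proof -
  have KS: "K * Sp \<in> carrier_mat m n" using K Sp by (rule mult_carrier_mat)
  have cR: "R \<in> carrier_mat m m" using R by (simp add: psd_def)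
  show ?thesis
    unfolding stage_cost_regroup[OF K cR]
    by (intro psd_add congruence_psd[OF C Q] congruence_psd[OF KS R])
qed

end

section \<open>Optimal feedback\<close>

text \<open>
  With \<open>M = R + B\<^sup>T P B\<close>, the expression on the left is a quadratic polynomial in \<open>L\<close> with leading
  term \<open>L\<^sup>T M L\<close>. The equation \<open>M Ls = B\<^sup>T P A\<close> makes \<open>Ls\<close> its stationary point.
\<close>

lemma completing_the_square:
  fixes A B P R L Ls :: "real mat"
  assumes A: "A \<in> carrier_mat n n" and B: "B \<in> carrier_mat n m"
    and P: "P \<in> carrier_mat n n" "P\<^sup>T = P" and R: "R \<in> carrier_mat m m" "R\<^sup>T = R"
    and L: "L \<in> carrier_mat m n" and Ls: "Ls \<in> carrier_mat m n"
    and opt: "(R + B\<^sup>T * P * B) * Ls = B\<^sup>T * P * A"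
  shows "L\<^sup>T * R * L + (A - B * L)\<^sup>T * P * (A - B * L)
    = A\<^sup>T * P * A - A\<^sup>T * P * B * Ls + (L - Ls)\<^sup>T * (R + B\<^sup>T * P * B) * (L - Ls)"
proof -
  define M where "M = R + B\<^sup>T * P * B"
  define N where "N = B\<^sup>T * P * A"
  have M: "M \<in> carrier_mat m m" using R B P by (auto simp: M_def)
  have N: "N \<in> carrier_mat m n" using A B P by (auto simp: N_def)
  note dims [simp] = carrier_matD[OF A] carrier_matD[OF B] carrier_matD[OF P(1)] carrier_matD[OF R(1)]
    carrier_matD[OF L] carrier_matD[OF Ls] carrier_matD[OF M] carrier_matD[OF N]
  have MT: "M\<^sup>T = M" by (simp add: M_def mat_distribs P(2) R(2))
  have NT: "N\<^sup>T = A\<^sup>T * P * B" by (simp add: N_def mat_distribs P(2))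
  have MLs: "M * Ls = N" using opt by (simp only: M_def N_def)
  have "Ls\<^sup>T * M = (M * Ls)\<^sup>T" by (simp add: transpose_mult_dim MT)
  then have LsM: "Ls\<^sup>T * M = N\<^sup>T" by (simp only: MLs)
  have 1: "(A - B * L)\<^sup>T * P * (A - B * L)
      = (A\<^sup>T * P * A - N\<^sup>T * L) - (L\<^sup>T * N - L\<^sup>T * (B\<^sup>T * P * B) * L)"
    unfolding NT by (intro eq_matI) (simp_all add: mat_distribs N_def del: index_mult_mat(1))
  have 2: "(L - Ls)\<^sup>T * M * (L - Ls) = (L\<^sup>T * M * L - N\<^sup>T * L) - (L\<^sup>T * N - N\<^sup>T * Ls)"
  proof -
    have "(L - Ls)\<^sup>T * M = L\<^sup>T * M - N\<^sup>T"
      by (simp add: transpose_minus_dim minus_mult_distrib_dim LsM)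
    then have "(L - Ls)\<^sup>T * M * (L - Ls) = (L\<^sup>T * M - N\<^sup>T) * L - (L\<^sup>T * M - N\<^sup>T) * Ls"
      by (simp add: mult_minus_distrib_dim)
    also have "\<dots> = (L\<^sup>T * M * L - N\<^sup>T * L) - (L\<^sup>T * M * Ls - N\<^sup>T * Ls)"
      by (simp add: minus_mult_distrib_dim)
    also have "L\<^sup>T * M * Ls = L\<^sup>T * N" using assoc_mult_dim[of "L\<^sup>T" M Ls] by (simp add: MLs)
    finally show ?thesis .
  qed
  have 3: "L\<^sup>T * M * L = L\<^sup>T * R * L + L\<^sup>T * (B\<^sup>T * P * B) * L"
    by (simp add: M_def mat_distribs)
  have "L\<^sup>T * R * L + ((A\<^sup>T * P * A - N\<^sup>T * L) - (L\<^sup>T * N - L\<^sup>T * (B\<^sup>T * P * B) * L))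
    = A\<^sup>T * P * A - N\<^sup>T * Ls
      + ((L\<^sup>T * R * L + L\<^sup>T * (B\<^sup>T * P * B) * L - N\<^sup>T * L) - (L\<^sup>T * N - N\<^sup>T * Ls))"
    by (rule eq_matI) (simp_all del: index_mult_mat(1))
  then show ?thesis unfolding M_def[symmetric] NT[symmetric] 1 2 3 .
qed

text \<open>
  Uniqueness for the Lyapunov equation is what makes the description in \<open>value_mat\<close> definite, so any
  semidefinite solution is the value matrix.
\<close>

lemma value_matI:
  assumes n: "0 < n" "dim_row A = n" and F: "closed_loop p A B C K \<in> carrier_mat n n"
    and sr: "spectral_radius (map_mat complex_of_real (closed_loop p A B C K)) < 1"
    and W: "C\<^sup>T * Q * C + (S_pinv p A B C)\<^sup>T * K\<^sup>T * R * K * S_pinv p A B C \<in> carrier_mat n n"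
    and P: "psd n P"
    and eq: "P = C\<^sup>T * Q * C + (S_pinv p A B C)\<^sup>T * K\<^sup>T * R * K * S_pinv p A B C
       + (closed_loop p A B C K)\<^sup>T * P * closed_loop p A B C K"
  shows "value_mat p A B C Q R K = P"
  unfolding value_mat_def n(2)
proof (rule the_equality)
  show "psd n P \<and> P = C\<^sup>T * Q * C + (S_pinv p A B C)\<^sup>T * K\<^sup>T * R * K * S_pinv p A B C
       + (closed_loop p A B C K)\<^sup>T * P * closed_loop p A B C K"
    using P eq by blast
next
  fix P' assume P': "psd n P' \<and> P' = C\<^sup>T * Q * C + (S_pinv p A B C)\<^sup>T * K\<^sup>T * R * K * S_pinv p A B C
       + (closed_loop p A B C K)\<^sup>T * P' * closed_loop p A B C K"
  show "P' = P"
    by (rule lyapunov_unique[OF F n(1) sr W _ _ conjunct2[OF P'] eq])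
      (use P P' in \<open>simp_all add: psd_def\<close>)
qed

lemma mtrace_comm:
  assumes X: "X \<in> carrier_mat k l" and Y: "Y \<in> carrier_mat l k"
  shows "mtrace (X * Y) = mtrace (Y * X)"
proof -
  have "mtrace (X * Y) = (\<Sum>i<k. \<Sum>j<l. X $$ (i, j) * Y $$ (j, i))"
    using X Y by (simp add: mtrace_def scalar_prod_def atLeast0LessThan)
  also have "\<dots> = (\<Sum>j<l. \<Sum>i<k. Y $$ (j, i) * X $$ (i, j))"
    by (subst sum.swap) (simp add: mult.commute)
  also have "\<dots> = mtrace (Y * X)"
    using X Y by (simp add: mtrace_def scalar_prod_def atLeast0LessThan)
  finally show ?thesis .
qed

lemma mtrace_add:
  "X \<in> carrier_mat k k \<Longrightarrow> Y \<in> carrier_mat k k \<Longrightarrow> mtrace (X + Y) = mtrace X + mtrace Y"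
  by (simp add: mtrace_def sum.distrib)

lemma minus_zero_imp_eq:
  fixes X Y :: "real mat"
  assumes X: "X \<in> carrier_mat k l" and Y: "Y \<in> carrier_mat k l" and z: "X - Y = 0\<^sub>m k l"
  shows "X = Y"
proof (rule eq_matI)
  fix i j assume ij: "i < dim_row Y" "j < dim_col Y"
  then have "(X - Y) $$ (i, j) = 0" unfolding z using Y by simp
  then show "X $$ (i, j) = Y $$ (i, j)" using ij by simp
qed (use X Y in auto)

lemma zero_congruence:
  "X \<in> carrier_mat k k \<Longrightarrow> (0\<^sub>m k l)\<^sup>T * X * 0\<^sub>m k l = (0\<^sub>m l l :: real mat)"
  by (intro eq_matI) auto

text \<open>
  Evaluated at \<open>v\<close>, the form of \<open>E\<^sup>T M E\<close> is that of \<open>M\<close> at \<open>E v\<close>.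
\<close>

lemma pd_congruence_zero:
  assumes M: "pd m M" and E: "E \<in> carrier_mat m n" and z: "E\<^sup>T * M * E = 0\<^sub>m n n"
  shows "E = 0\<^sub>m m n"
proof -
  have cM: "M \<in> carrier_mat m m" using M by (simp add: pd_def)
  have Ev: "E *\<^sub>v v = 0\<^sub>v m" if v: "v \<in> carrier_vec n" for v
  proof (rule ccontr)
    assume "E *\<^sub>v v \<noteq> 0\<^sub>v m"
    then have "0 < (E *\<^sub>v v) \<bullet> (M *\<^sub>v (E *\<^sub>v v))" using M E v by (simp add: pd_def)
    also have "\<dots> = v \<bullet> (E\<^sup>T *\<^sub>v (M *\<^sub>v (E *\<^sub>v v)))"
      using scalar_prod_transpose[of v "E\<^sup>T" "M *\<^sub>v (E *\<^sub>v v)"] E cM v by simp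
    also have "E\<^sup>T *\<^sub>v (M *\<^sub>v (E *\<^sub>v v)) = E\<^sup>T * M * E *\<^sub>v v"
      using E cM v by (simp add: mult_mat_vec_dim)
    also have "E\<^sup>T * M * E *\<^sub>v v = 0\<^sub>v n" unfolding z using v by (intro eq_vecI) auto
    also have "v \<bullet> 0\<^sub>v n = 0" using v by simp
    finally show False by simp
  qed
  show ?thesis
  proof (rule eq_matI)
    fix i j assume ij: "i < dim_row (0\<^sub>m m n :: real mat)" "j < dim_col (0\<^sub>m m n :: real mat)"
    then have "E $$ (i, j) = (E *\<^sub>v unit_vec n j) $ i" using E by (simp add: scalar_prod_right_unit)
    also have "\<dots> = 0" using Ev[of "unit_vec n j"] ij by simp
    finally show "E $$ (i, j) = 0\<^sub>m m n $$ (i, j)" using ij by simp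
  qed (use E in auto)
qed

lemma pd_add_psd: "pd k X \<Longrightarrow> psd k Y \<Longrightarrow> pd k (X + Y)"
  unfolding pd_def psd_def
  by (auto simp: transpose_add_dim add_mult_distrib_mat_vec[of _ k k] scalar_prod_add_distrib[of _ k]
      intro!: add_pos_nonneg)

lemma pd_imp_psd:
  assumes "pd k M" shows "psd k M"
proof -
  have "0 \<le> x \<bullet> (M *\<^sub>v x)" if "x \<in> carrier_vec k" for x
    using assms that by (cases "x = 0\<^sub>v k") (auto simp: pd_def intro: less_imp_le)
  then show ?thesis using assms by (simp add: pd_def psd_def)
qed

text \<open>
  The optimal feedback \<open>gain\<close> is named apart from the policy \<open>K_opt = gain * S\<close> that realises it, since
  only the feedback enters the cost.
\<close>

locale lq_problem = observed_system n m d p A B C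
  for n m d p :: nat and A B C :: "real mat" +
  fixes Q R P :: "real mat" and \<Omega> :: "'w measure" and x0 :: "'w \<Rightarrow> real Matrix.vec"
  assumes Q: "psd d Q" and R: "pd m R"
    and x0: "square_integrable_vec n \<Omega> x0" and Sigma: "pd n (second_moment n \<Omega> x0)"
    and P: "riccati_psd_solution A B C Q R P"
begin

abbreviation "\<Sigma> \<equiv> second_moment n \<Omega> x0"
abbreviation "M \<equiv> R + B\<^sup>T * P * B"
abbreviation "gain \<equiv> minv M * B\<^sup>T * P * A"

lemma psd_P: "psd n P" and cP: "P \<in> carrier_mat n n" and P_sym: "P\<^sup>T = P"
  using P A by (auto simp: riccati_psd_solution_def psd_def)

lemma cQ: "Q \<in> carrier_mat d d" and cR: "R \<in> carrier_mat m m" and R_sym: "R\<^sup>T = R"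
  using Q R by (auto simp: pd_def psd_def)

lemma M_pd: "pd m M"
  by (rule pd_add_psd[OF R congruence_psd[OF B psd_P]])

lemma cM: "M \<in> carrier_mat m m"
  using M_pd by (simp add: pd_def)

lemmas minv_M = minv_inverts[OF cM pd_det_nonzero[OF M_pd]]

lemma gain: "gain \<in> carrier_mat m n"
  using minv_M(1) A B cP by (auto intro!: mult_carrier_mat)

lemma M_gain: "M * gain = B\<^sup>T * P * A"
proof -
  define Mi where "Mi = minv M"
  have Mi: "Mi \<in> carrier_mat m m" "M * Mi = 1\<^sub>m m" using minv_M by (simp_all only: Mi_def)
  note [simp] = carrier_matD[OF A] carrier_matD[OF B] carrier_matD[OF cP] carrier_matD[OF Mi(1)]
  have "gain = Mi * (B\<^sup>T * P * A)" unfolding Mi_def[symmetric] by (simp add: assoc_mult_dim)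
  also have "M * (Mi * (B\<^sup>T * P * A)) = B\<^sup>T * P * A"
    by (rule left_cancel_dim[OF Mi(2)]) (use cM in simp_all)
  finally show ?thesis .
qed

lemma K_opt: "K_opt p A B C R P = gain * S"
  by (simp add: K_opt_def)

lemma K_opt_carrier: "K_opt p A B C R P \<in> carrier_mat m q"
  unfolding K_opt using gain S by (rule mult_carrier_mat)

lemma K_opt_Sp: "K_opt p A B C R P * Sp = gain"
  unfolding K_opt using assoc_mult_mat[OF gain S Sp] S_Sp right_mult_one_mat[OF gain] by simp

text \<open>
  By completing the square, \<open>P\<close> solves the value equation of \<open>K\<close> up to the defect
  \<open>G = (K S\<^sup>\<dagger> - gain)\<^sup>T M (K S\<^sup>\<dagger> - gain)\<close>. The equation is affine, so adding to \<open>P\<close> the solution \<open>D\<close> of the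
  Lyapunov equation with right-hand side \<open>G\<close> gives a solution, which is then the value matrix.
\<close>

lemma value_mat_gap:
  assumes K: "K \<in> feasible p A B C"
  obtains D where "psd n D" "value_mat p A B C Q R K = P + D"
    "D = (K * Sp - gain)\<^sup>T * M * (K * Sp - gain) + (F K)\<^sup>T * D * F K"
proof -
  have cK: "K \<in> carrier_mat m q" and sr: "spectral_radius (map_mat complex_of_real (F K)) < 1"
    using K by (auto simp: feasible_iff)
  define L where "L = K * Sp"
  have L: "L \<in> carrier_mat m n" unfolding L_def using cK Sp by (rule mult_carrier_mat)
  have F: "F K \<in> carrier_mat n n" by (rule closed_loop_carrier[OF cK])
  have E: "L - gain \<in> carrier_mat m n" using gain by (rule minus_carrier_mat)
  define G where "G = (L - gain)\<^sup>T * M * (L - gain)"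
  have G: "psd n G" unfolding G_def by (rule congruence_psd[OF E pd_imp_psd[OF M_pd]])
  obtain D where D: "psd n D" "D = G + (F K)\<^sup>T * D * F K"
    using lyapunov_exists[OF F n_pos sr G] by blast
  have cD: "D \<in> carrier_mat n n" and cG: "G \<in> carrier_mat n n" using D G by (auto simp: psd_def)
  note [simp] = carrier_matD[OF A] carrier_matD[OF B] carrier_matD[OF cP] carrier_matD[OF cM]
    carrier_matD[OF C] carrier_matD[OF cQ] carrier_matD[OF cR] carrier_matD[OF gain] carrier_matD[OF cD]
    carrier_matD[OF cG] carrier_matD[OF F] carrier_matD[OF L] carrier_matD[OF minv_M(1)]
  have sq: "L\<^sup>T * R * L + (F K)\<^sup>T * P * F K = A\<^sup>T * P * A - A\<^sup>T * P * B * gain + G"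
    unfolding G_def closed_loop_eq[OF cK] L_def[symmetric]
    by (rule completing_the_square[OF A B cP P_sym cR R_sym L gain M_gain])
  have ric: "P = A\<^sup>T * P * A + C\<^sup>T * Q * C - A\<^sup>T * P * B * gain"
  proof -
    have "A\<^sup>T * P * B * minv M * B\<^sup>T * P * A = A\<^sup>T * P * B * gain"
    proof -
      define Mi where "Mi = minv M"
      have "Mi \<in> carrier_mat m m" using minv_M(1) by (simp only: Mi_def)
      note [simp] = carrier_matD[OF this]
      show ?thesis unfolding Mi_def[symmetric] by (simp add: assoc_mult_dim)
    qed
    then show ?thesis using P unfolding riccati_psd_solution_def by simp
  qed
  have "C\<^sup>T * Q * C + L\<^sup>T * R * L + (F K)\<^sup>T * (P + D) * F K
      = C\<^sup>T * Q * C + (L\<^sup>T * R * L + (F K)\<^sup>T * P * F K) + (F K)\<^sup>T * D * F K"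
  proof -
    have "(F K)\<^sup>T * (P + D) * F K = (F K)\<^sup>T * P * F K + (F K)\<^sup>T * D * F K"
      by (simp add: mat_distribs)
    then show ?thesis by (intro eq_matI) (simp_all del: index_mult_mat(1))
  qed
  also have "\<dots> = (A\<^sup>T * P * A + C\<^sup>T * Q * C - A\<^sup>T * P * B * gain) + (G + (F K)\<^sup>T * D * F K)"
    unfolding sq by (intro eq_matI) (simp_all del: index_mult_mat(1))
  also have "\<dots> = P + D" using ric D(2) by simp
  finally have eq: "P + D = C\<^sup>T * Q * C + L\<^sup>T * R * L + (F K)\<^sup>T * (P + D) * F K" ..
  have "value_mat p A B C Q R K = P + D"
  proof (rule value_matI[OF n_pos _ F sr])
    show "C\<^sup>T * Q * C + Sp\<^sup>T * K\<^sup>T * R * K * Sp \<in> carrier_mat n n"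
      using stage_cost_psd[OF cK Q pd_imp_psd[OF R]] by (simp add: psd_def)
    show "P + D = C\<^sup>T * Q * C + Sp\<^sup>T * K\<^sup>T * R * K * Sp + (F K)\<^sup>T * (P + D) * F K"
      unfolding stage_cost_regroup[OF cK cR] L_def[symmetric] by (rule eq)
  qed (simp_all add: psd_add psd_P D(1))
  then show thesis using that[OF D(1)] D(2) unfolding G_def L_def by blast
qed

text \<open>
  For the optimal gain the defect \<open>G\<close> vanishes, and with it \<open>D\<close>, by uniqueness
  for the Lyapunov equation.
\<close>

lemma value_mat_of_gain:
  assumes K: "K \<in> feasible p A B C" and L: "K * Sp = gain"
  shows "value_mat p A B C Q R K = P"
proof -
  obtain D where D: "psd n D" "value_mat p A B C Q R K = P + D"
    "D = (K * Sp - gain)\<^sup>T * M * (K * Sp - gain) + (F K)\<^sup>T * D * F K"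
    using value_mat_gap[OF K] by blast
  have F: "F K \<in> carrier_mat n n" and sr: "spectral_radius (map_mat complex_of_real (F K)) < 1"
    using K closed_loop_carrier by (auto simp: feasible_iff)
  have cD: "D \<in> carrier_mat n n" using D by (simp add: psd_def)
  have z: "(K * Sp - gain)\<^sup>T * M * (K * Sp - gain) = 0\<^sub>m n n"
    unfolding L minus_r_inv_mat[OF gain] by (rule zero_congruence[OF cM])
  have eD: "D = 0\<^sub>m n n + (F K)\<^sup>T * D * F K" using D(3) unfolding z .
  have e0: "0\<^sub>m n n = 0\<^sub>m n n + (F K)\<^sup>T * 0\<^sub>m n n * F K" using F by simp
  have "D = 0\<^sub>m n n"
    by (rule lyapunov_unique[OF F n_pos sr _ cD _ eD e0]) simp_all
  then show ?thesis using D(2) cP by simp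
qed

text \<open>
  The cost of a feasible policy exceeds \<open>tr (P \<Sigma>)\<close> by \<open>tr (D \<Sigma>) \<ge> 0\<close>, and the feasible policy \<open>K_opt\<close>
  attains this bound. Equality forces \<open>D = 0\<close>, hence \<open>G = 0\<close>, hence \<open>K S\<^sup>\<dagger> = gain\<close>.
\<close>

theorem optimal_policy_iff:
  assumes star: "K_opt p A B C R P \<in> feasible p A B C"
  shows "optimal_policy p A B C Q R \<Sigma> K \<longleftrightarrow> K \<in> carrier_mat m q \<and> K * Sp = gain"
proof -
  have cSigma: "\<Sigma> \<in> carrier_mat n n" using Sigma by (simp add: pd_def)
  have gap: "mtrace ((P + D) * \<Sigma>) = mtrace (P * \<Sigma>) + mtrace (D * \<Sigma>)" if "psd n D" for D
  proof -
    have cD: "D \<in> carrier_mat n n" using that by (simp add: psd_def)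
    show ?thesis
      unfolding add_mult_distrib_mat[OF cP cD cSigma]
      by (rule mtrace_add[of _ n]) (use cP cD cSigma in auto)
  qed
  have lower: "mtrace (P * \<Sigma>) \<le> cost p A B C Q R \<Sigma> K'" if K': "K' \<in> feasible p A B C" for K'
  proof -
    obtain D where D: "psd n D" "value_mat p A B C Q R K' = P + D"
      using value_mat_gap[OF K'] by blast
    then show ?thesis
      using gap[OF D(1)] trace_psd_second_moment(1)[OF x0 D(1) Sigma] by (simp add: cost_def)
  qed
  show ?thesis
  proof
    assume opt: "optimal_policy p A B C Q R \<Sigma> K"
    then have K: "K \<in> feasible p A B C" and cK: "K \<in> carrier_mat m q"
      by (auto simp: optimal_policy_def feasible_iff)
    obtain D where D: "psd n D" "value_mat p A B C Q R K = P + D"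
      "D = (K * Sp - gain)\<^sup>T * M * (K * Sp - gain) + (F K)\<^sup>T * D * F K"
      using value_mat_gap[OF K] by blast
    have F: "F K \<in> carrier_mat n n" by (rule closed_loop_carrier[OF cK])
    have KS: "K * Sp \<in> carrier_mat m n" using cK Sp by (rule mult_carrier_mat)
    have E: "K * Sp - gain \<in> carrier_mat m n" using gain by (rule minus_carrier_mat)
    have "cost p A B C Q R \<Sigma> K \<le> cost p A B C Q R \<Sigma> (K_opt p A B C R P)"
      using opt star by (simp add: optimal_policy_def)
    also have "\<dots> = mtrace (P * \<Sigma>)"
      unfolding cost_def value_mat_of_gain[OF star K_opt_Sp] ..
    finally have "mtrace (D * \<Sigma>) \<le> 0" using gap[OF D(1)] D(2) by (simp add: cost_def)
    then have "mtrace (D * \<Sigma>) = 0"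
      using trace_psd_second_moment(1)[OF x0 D(1) Sigma] by linarith
    then have D0: "D = 0\<^sub>m n n"
      by (rule trace_psd_second_moment(2)[OF x0 D(1) Sigma])
    have F0: "(F K)\<^sup>T * 0\<^sub>m n n * F K = 0\<^sub>m n n" using F by simp
    have G: "(K * Sp - gain)\<^sup>T * M * (K * Sp - gain) \<in> carrier_mat n n"
      by (rule mult_carrier_mat[OF mult_carrier_mat[OF _ cM] E]) (use E in simp)
    have "0\<^sub>m n n = (K * Sp - gain)\<^sup>T * M * (K * Sp - gain) + 0\<^sub>m n n"
      using D(3) unfolding D0 F0 .
    then have "(K * Sp - gain)\<^sup>T * M * (K * Sp - gain) = 0\<^sub>m n n"
      unfolding right_add_zero_mat[OF G] ..
    then have z: "K * Sp - gain = 0\<^sub>m m n" by (rule pd_congruence_zero[OF M_pd E])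
    have "K * Sp = gain" by (rule minus_zero_imp_eq[OF KS gain z])
    then show "K \<in> carrier_mat m q \<and> K * Sp = gain" using cK by blast
  next
    assume K: "K \<in> carrier_mat m q \<and> K * Sp = gain"
    then have "F K = F (K_opt p A B C R P)"
      by (simp add: closed_loop_eq K_opt_carrier K_opt_Sp)
    then have fK: "K \<in> feasible p A B C" using star K by (simp add: feasible_iff)
    have "cost p A B C Q R \<Sigma> K = mtrace (P * \<Sigma>)"
      unfolding cost_def value_mat_of_gain[OF fK conjunct2[OF K]] ..
    then show "optimal_policy p A B C Q R \<Sigma> K"
      using fK lower by (simp add: optimal_policy_def)
  qed
qed

end

section \<open>Invariance under similarity\<close>

lemma spectral_radius_similar:
  fixes F :: "real mat"
  assumes F: "F \<in> carrier_mat n n" and T: "T \<in> carrier_mat n n" "Ti \<in> carrier_mat n n"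
    and inv: "T * Ti = 1\<^sub>m n" "Ti * T = 1\<^sub>m n"
  shows "spectral_radius (map_mat complex_of_real (T * F * Ti)) = spectral_radius (map_mat complex_of_real F)"
proof -
  have TF: "T * F * Ti \<in> carrier_mat n n" using F T by auto
  have "similar_mat (T * F * Ti) F"
    unfolding similar_mat_def similar_mat_wit_def Let_def
    by (intro exI[of _ T] exI[of _ Ti]) (use TF F T inv in auto)
  then have "char_poly (T * F * Ti) = char_poly F" by (rule char_poly_similar)
  then have "char_poly (map_mat complex_of_real (T * F * Ti)) = char_poly (map_mat complex_of_real F)"
    by (simp add: of_real_hom.char_poly_hom[OF TF] of_real_hom.char_poly_hom[OF F])
  then show ?thesis
    using TF F by (simp add: spectral_radius_def spectrum_root_char_poly[of _ n])
qed

lemma second_moment_carrier: "second_moment n \<Omega> x \<in> carrier_mat n n"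
  by (simp add: second_moment_def)

text \<open>
  The inverse of \<open>T\<close> is a parameter of its own, so that rewriting meets an atom and can cancel it.
\<close>

locale similar_system = observed_system n m d p A B C
  for n m d p :: nat and A B C :: "real mat" +
  fixes T Ti :: "real mat"
  assumes T: "T \<in> carrier_mat n n" and Ti: "Ti \<in> carrier_mat n n"
    and T_Ti: "T * Ti = 1\<^sub>m n" and Ti_T: "Ti * T = 1\<^sub>m n"
begin

abbreviation "A' \<equiv> T * A * Ti"
abbreviation "B' \<equiv> T * B"
abbreviation "C' \<equiv> C * Ti"

lemmas state_dims = carrier_matD[OF A] carrier_matD[OF B] carrier_matD[OF C] carrier_matD[OF T] carrier_matD[OF Ti]

lemma cancel_Ti_T: "dim_row X = n \<Longrightarrow> Ti * (T * X) = X"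
  by (rule left_cancel_dim[OF Ti_T]) (simp_all add: state_dims)

lemma cancel_T_Ti: "dim_row X = n \<Longrightarrow> T * (Ti * X) = X"
  by (rule left_cancel_dim[OF T_Ti]) (simp_all add: state_dims)

lemma transpose_T_Ti: "T\<^sup>T * Ti\<^sup>T = 1\<^sub>m n"
  using arg_cong[OF Ti_T, of transpose_mat] transpose_mult[OF Ti T] by simp

lemma transpose_Ti_T: "Ti\<^sup>T * T\<^sup>T = 1\<^sub>m n"
  using arg_cong[OF T_Ti, of transpose_mat] transpose_mult[OF T Ti] by simp

lemma cancel_transpose_T_Ti: "dim_row X = n \<Longrightarrow> T\<^sup>T * (Ti\<^sup>T * X) = X"
  by (rule left_cancel_dim[OF transpose_T_Ti]) (simp_all add: state_dims)

lemma cancel_transpose_Ti_T: "dim_row X = n \<Longrightarrow> Ti\<^sup>T * (T\<^sup>T * X) = X"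
  by (rule left_cancel_dim[OF transpose_Ti_T]) (simp_all add: state_dims)

lemmas cancels = cancel_Ti_T cancel_T_Ti cancel_transpose_T_Ti cancel_transpose_Ti_T

lemma similar_carriers:
  shows "A' \<in> carrier_mat n n" "B' \<in> carrier_mat n m" "C' \<in> carrier_mat d n"
  using A B C T Ti by auto

lemma pow_dims: "dim_row (A ^\<^sub>m k) = n" "dim_col (A ^\<^sub>m k) = n"
  using carrier_matD[OF pow_carrier_mat[OF A, of k]] .

lemma similar_pow: "A' ^\<^sub>m k = T * A ^\<^sub>m k * Ti"
proof (induction k)
  case 0
  then show ?case using T_Ti right_mult_one_mat[OF T] A T by simp
next
  case (Suc k)
  have "A' ^\<^sub>m Suc k = (T * A ^\<^sub>m k * Ti) * (T * A * Ti)" using Suc by simp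
  also have "\<dots> = T * (A ^\<^sub>m k * A) * Ti"
    by (simp add: assoc_mult_dim cancels state_dims pow_dims)
  finally show ?case by simp
qed

lemma similar_obsv: "obsv_mat k C' A' = obsv_mat k C A * Ti"
proof (rule eq_matI)
  have O: "obsv_mat k C A \<in> carrier_mat (k * d) n" by (rule obsv_mat_carrier[OF C])
  have O': "obsv_mat k C' A' \<in> carrier_mat (k * d) n" by (rule obsv_mat_carrier[OF similar_carriers(3)])
  show "dim_row (obsv_mat k C' A') = dim_row (obsv_mat k C A * Ti)"
    and "dim_col (obsv_mat k C' A') = dim_col (obsv_mat k C A * Ti)"
    using O O' Ti by simp_all
  fix i j assume "i < dim_row (obsv_mat k C A * Ti)" "j < dim_col (obsv_mat k C A * Ti)"
  then have i: "i < k * d" and j: "j < n" using O Ti by simp_all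
  then have "0 < d" by (cases d) auto
  then have id: "i mod d < d" by simp
  define e where "e = k - 1 - i div d"
  have "C' * A' ^\<^sub>m e = (C * A ^\<^sub>m e) * Ti"
    unfolding similar_pow by (simp add: assoc_mult_dim cancels state_dims pow_dims)
  then have r: "row (obsv_mat k C' A') i = row ((C * A ^\<^sub>m e) * Ti) (i mod d)"
    using row_obsv_mat[OF similar_carriers(1) similar_carriers(3) i] by (simp only: e_def)
  have "obsv_mat k C' A' $$ (i, j) = row (obsv_mat k C' A') i $ j" using O' i j by simp
  also have "\<dots> = ((C * A ^\<^sub>m e) * Ti) $$ (i mod d, j)"
    unfolding r using id j by (intro index_row) (simp_all add: state_dims)
  also have "\<dots> = row (C * A ^\<^sub>m e) (i mod d) \<bullet> col Ti j"
    using id j by (intro index_mult_mat(1)) (simp_all add: state_dims)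
  also have "\<dots> = row (obsv_mat k C A) i \<bullet> col Ti j"
    unfolding row_obsv_mat[OF A C i] e_def ..
  also have "\<dots> = (obsv_mat k C A * Ti) $$ (i, j)" using O Ti i j by simp
  finally show "obsv_mat k C' A' $$ (i, j) = (obsv_mat k C A * Ti) $$ (i, j)" .
qed

lemma similar_ctrb: "ctrb_mat k A' B' = T * ctrb_mat k A B"
proof (rule eq_matI)
  have O: "ctrb_mat k A B \<in> carrier_mat n (k * m)" by (rule ctrb_mat_carrier[OF B])
  have O': "ctrb_mat k A' B' \<in> carrier_mat n (k * m)" by (rule ctrb_mat_carrier[OF similar_carriers(2)])
  show "dim_row (ctrb_mat k A' B') = dim_row (T * ctrb_mat k A B)"
    and "dim_col (ctrb_mat k A' B') = dim_col (T * ctrb_mat k A B)"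
    using O O' T by simp_all
  fix i j assume "i < dim_row (T * ctrb_mat k A B)" "j < dim_col (T * ctrb_mat k A B)"
  then have i: "i < n" and j: "j < k * m" using O T by simp_all
  then have "0 < m" by (cases m) auto
  then have jm: "j mod m < m" by simp
  define e where "e = j div m"
  have "A' ^\<^sub>m e * B' = T * (A ^\<^sub>m e * B)"
    unfolding similar_pow by (simp add: assoc_mult_dim cancels state_dims pow_dims)
  then have c: "col (ctrb_mat k A' B') j = col (T * (A ^\<^sub>m e * B)) (j mod m)"
    using col_ctrb_mat[OF similar_carriers(1) similar_carriers(2) j] by (simp only: e_def)
  have "ctrb_mat k A' B' $$ (i, j) = col (ctrb_mat k A' B') j $ i" using O' i j by simp
  also have "\<dots> = (T * (A ^\<^sub>m e * B)) $$ (i, j mod m)"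
    unfolding c using jm i by (intro index_col) (simp_all add: state_dims)
  also have "\<dots> = row T i \<bullet> col (A ^\<^sub>m e * B) (j mod m)"
    using jm i by (intro index_mult_mat(1)) (simp_all add: state_dims)
  also have "\<dots> = row T i \<bullet> col (ctrb_mat k A B) j"
    unfolding col_ctrb_mat[OF A B j] e_def ..
  also have "\<dots> = (T * ctrb_mat k A B) $$ (i, j)" using O T i j by simp
  finally show "ctrb_mat k A' B' $$ (i, j) = (T * ctrb_mat k A B) $$ (i, j)" .
qed

lemma similar_toeplitz: "toeplitz_mat k A' B' C' = toeplitz_mat k A B C"
proof -
  have "C' * A' ^\<^sub>m e * B' = C * A ^\<^sub>m e * B" for e
    unfolding similar_pow by (simp add: assoc_mult_dim cancels state_dims pow_dims)
  then have "(\<lambda>e. C' * A' ^\<^sub>m e * B') = (\<lambda>e. C * A ^\<^sub>m e * B)" by (rule ext)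
  note Markov = fun_cong[OF this]
  have "dim_row C' = dim_row C" "dim_col B' = dim_col B" by simp_all
  then show ?thesis unfolding toeplitz_mat_def Markov by presburger
qed

text \<open>
  The pseudoinverse of \<open>Obs Ti\<close> is \<open>T\<close> times that of \<open>Obs\<close> because \<open>Obs\<close> has full column rank; for a
  general matrix such a product rule fails.
\<close>

lemma similar_left_pinv: "left_pinv (obsv_mat p C' A') = T * left_pinv Obs"
proof -
  define G where "G = minv (Obs\<^sup>T * Obs)"
  have G: "G \<in> carrier_mat n n" and OG: "Obs\<^sup>T * Obs * G = 1\<^sub>m n"
    unfolding G_def by (rule Obs_gram_inverse)+
  note dims = state_dims carrier_matD[OF G] carrier_matD[OF Obs]
  have OG': "Obs\<^sup>T * (Obs * (G * X)) = X" if "dim_row X = n" for X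
  proof -
    have "Obs\<^sup>T * (Obs * (G * X)) = Obs\<^sup>T * Obs * (G * X)" by (simp add: assoc_mult_dim dims that)
    also have "\<dots> = X" by (rule left_cancel_dim[OF OG]) (simp_all add: dims that)
    finally show ?thesis .
  qed
  have "minv ((Obs * Ti)\<^sup>T * (Obs * Ti)) = T * G * T\<^sup>T"
  proof (rule minv_unique)
    show "(Obs * Ti)\<^sup>T * (Obs * Ti) \<in> carrier_mat n n"
      by (rule carrier_matI) (simp_all add: dims)
    show "T * G * T\<^sup>T \<in> carrier_mat n n" by (rule carrier_matI) (simp_all add: dims)
    have "(Obs * Ti)\<^sup>T * (Obs * Ti) * (T * G * T\<^sup>T) = Ti\<^sup>T * T\<^sup>T"
      by (simp add: assoc_mult_dim transpose_mult_dim cancels OG' dims)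
    then show "(Obs * Ti)\<^sup>T * (Obs * Ti) * (T * G * T\<^sup>T) = 1\<^sub>m n" by (simp only: transpose_Ti_T)
  qed
  then have "left_pinv (Obs * Ti) = T * G * T\<^sup>T * (Obs * Ti)\<^sup>T" by (simp only: left_pinv_def)
  also have "\<dots> = T * (G * Obs\<^sup>T)"
    by (simp add: assoc_mult_dim transpose_mult_dim cancels dims)
  finally show ?thesis unfolding similar_obsv by (simp only: left_pinv_def G_def)
qed

lemma similar_S: "S_mat p A' B' C' = T * S"
proof -
  note dims = state_dims pow_dims carrier_matD[OF left_pinv_Obs] carrier_matD[OF Ctr] carrier_matD[OF Toep]
  have 1: "A' ^\<^sub>m p * (T * left_pinv Obs) = T * (A ^\<^sub>m p * left_pinv Obs)"
    unfolding similar_pow by (simp add: assoc_mult_dim cancels dims)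
  have 2: "T * Ctr - T * (A ^\<^sub>m p * left_pinv Obs) * Toep = T * (Ctr - A ^\<^sub>m p * left_pinv Obs * Toep)"
    by (simp add: assoc_mult_dim mult_minus_distrib_dim dims)
  show ?thesis
    unfolding S_mat_def similar_ctrb similar_toeplitz similar_left_pinv 1 2
    by (rule mult_hcat[OF T S_blocks, symmetric])
qed

text \<open>
  Both representations compute the state from the same inputs and outputs, so \<open>S\<close> becomes \<open>T S\<close>. As
  \<open>S\<close> has full row rank and \<open>T\<close> is nonsingular, the pseudoinverse of \<open>T S\<close> is \<open>S\<^sup>\<dagger> Ti\<close>.
\<close>

lemma similar_Sp: "S_pinv p A' B' C' = Sp * Ti"
proof -
  define G where "G = minv (S * S\<^sup>T)"
  have G: "G \<in> carrier_mat n n" and SG: "S * S\<^sup>T * G = 1\<^sub>m n"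
    unfolding G_def by (rule S_gram_inverse)+
  note dims = state_dims carrier_matD[OF G] carrier_matD[OF S]
  have SG': "S * (S\<^sup>T * (G * X)) = X" if "dim_row X = n" for X
  proof -
    have "S * (S\<^sup>T * (G * X)) = S * S\<^sup>T * (G * X)" by (simp add: assoc_mult_dim dims that)
    also have "\<dots> = X" by (rule left_cancel_dim[OF SG]) (simp_all add: dims that)
    finally show ?thesis .
  qed
  have "minv ((T * S) * (T * S)\<^sup>T) = Ti\<^sup>T * G * Ti"
  proof (rule minv_unique)
    show "(T * S) * (T * S)\<^sup>T \<in> carrier_mat n n"
      by (rule carrier_matI) (simp_all add: dims)
    show "Ti\<^sup>T * G * Ti \<in> carrier_mat n n" by (rule carrier_matI) (simp_all add: dims)
    have "(T * S) * (T * S)\<^sup>T * (Ti\<^sup>T * G * Ti) = T * Ti"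
      by (simp add: assoc_mult_dim transpose_mult_dim cancels SG' dims)
    then show "(T * S) * (T * S)\<^sup>T * (Ti\<^sup>T * G * Ti) = 1\<^sub>m n" by (simp only: T_Ti)
  qed
  then have "right_pinv (T * S) = (T * S)\<^sup>T * (Ti\<^sup>T * G * Ti)" by (simp only: right_pinv_def)
  also have "\<dots> = S\<^sup>T * G * Ti"
    by (simp add: assoc_mult_dim transpose_mult_dim cancels dims)
  finally show ?thesis unfolding S_pinv_def similar_S by (simp only: right_pinv_def G_def)
qed

lemma similar_closed_loop:
  assumes K: "K \<in> carrier_mat m q"
  shows "closed_loop p A' B' C' K = T * closed_loop p A B C K * Ti"
  unfolding closed_loop_def similar_Sp
  by (simp add: assoc_mult_dim mult_minus_distrib_dim minus_mult_distrib_dim state_dims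
      carrier_matD[OF K] carrier_matD[OF Sp])

text \<open>
  The closed loop of the transformed system is similar to the original one under the same \<open>K\<close>.
\<close>

lemma similar_feasible: "feasible p A' B' C' = feasible p A B C"
proof -
  have "dim_col B' = m" "dim_row C' = d" by (simp_all add: state_dims)
  then show ?thesis
    unfolding feasible_def
    using spectral_radius_similar[OF closed_loop_carrier T Ti T_Ti Ti_T]
    by (auto simp: state_dims similar_closed_loop)
qed

lemma similar_value:
  assumes K: "K \<in> feasible p A B C"
    and cQ: "Q \<in> carrier_mat d d" and cR: "R \<in> carrier_mat m m" and P: "psd n P"
    and eq: "P = C\<^sup>T * Q * C + Sp\<^sup>T * K\<^sup>T * R * K * Sp
       + (F K)\<^sup>T * P * F K"
  shows "value_mat p A' B' C' Q R K = Ti\<^sup>T * P * Ti"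
proof -
  have cK: "K \<in> carrier_mat m q" using K by (simp add: feasible_def state_dims)
  define G where "G = F K"
  have G: "G \<in> carrier_mat n n" unfolding G_def by (rule closed_loop_carrier[OF cK])
  have G': "closed_loop p A' B' C' K = T * G * Ti"
    unfolding G_def by (rule similar_closed_loop[OF cK])
  have cP: "P \<in> carrier_mat n n" using P by (simp add: psd_def)
  note dims = state_dims carrier_matD[OF cK] carrier_matD[OF G] carrier_matD[OF Sp]
    carrier_matD[OF cQ] carrier_matD[OF cR] carrier_matD[OF cP]
  show ?thesis
  proof (rule value_matI[OF n_pos])
    show "dim_row A' = n" by (simp add: dims)
    show "closed_loop p A' B' C' K \<in> carrier_mat n n"
      unfolding G' by (rule carrier_matI) (simp_all add: dims)
    show "spectral_radius (map_mat complex_of_real (closed_loop p A' B' C' K)) < 1"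
      using K[folded similar_feasible] by (simp add: feasible_def)
    show "C'\<^sup>T * Q * C' + (S_pinv p A' B' C')\<^sup>T * K\<^sup>T * R * K * S_pinv p A' B' C' \<in> carrier_mat n n"
      unfolding similar_Sp by (rule carrier_matI) (simp_all add: dims)
    show "psd n (Ti\<^sup>T * P * Ti)" by (rule congruence_psd[OF Ti P])
    have "Ti\<^sup>T * P * Ti = Ti\<^sup>T * (C\<^sup>T * Q * C + Sp\<^sup>T * K\<^sup>T * R * K * Sp + G\<^sup>T * P * G) * Ti"
      using eq by (simp only: G_def)
    also have "\<dots> = C'\<^sup>T * Q * C' + (Sp * Ti)\<^sup>T * K\<^sup>T * R * K * (Sp * Ti)
        + (T * G * Ti)\<^sup>T * (Ti\<^sup>T * P * Ti) * (T * G * Ti)"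
      by (simp add: mat_distribs cancels dims)
    finally show "Ti\<^sup>T * P * Ti = C'\<^sup>T * Q * C' + (S_pinv p A' B' C')\<^sup>T * K\<^sup>T * R * K * S_pinv p A' B' C'
        + (closed_loop p A' B' C' K)\<^sup>T * (Ti\<^sup>T * P * Ti) * closed_loop p A' B' C' K"
      unfolding similar_Sp G' .
  qed
qed

text \<open>
  Value matrices transform by the congruence with \<open>Ti\<close> and second moments by the one with \<open>T\<^sup>T\<close>, so the
  trace of their product is unchanged by cyclicity.
\<close>

lemma similar_cost:
  assumes K: "K \<in> feasible p A B C" and Q: "psd d Q" and R: "psd m R"
    and Sig: "\<Sigma> \<in> carrier_mat n n"
  shows "cost p A' B' C' Q R (T * \<Sigma> * T\<^sup>T) K = cost p A B C Q R \<Sigma> K"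
proof -
  have cK: "K \<in> carrier_mat m q" and sr: "spectral_radius (map_mat complex_of_real (F K)) < 1"
    using K by (simp_all add: feasible_def state_dims)
  have F: "F K \<in> carrier_mat n n" by (rule closed_loop_carrier[OF cK])
  have cQ: "Q \<in> carrier_mat d d" and cR: "R \<in> carrier_mat m m" using Q R by (auto simp: psd_def)
  let ?W = "C\<^sup>T * Q * C + Sp\<^sup>T * K\<^sup>T * R * K * Sp"
  have W: "psd n ?W" by (rule stage_cost_psd[OF cK Q R])
  then have cW: "?W \<in> carrier_mat n n" by (simp add: psd_def)
  obtain P where P: "psd n P" "P = ?W + (F K)\<^sup>T * P * F K"
    using lyapunov_exists[OF F n_pos sr W] by blast
  have cP: "P \<in> carrier_mat n n" using P by (simp add: psd_def)
  have v: "value_mat p A B C Q R K = P"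
    by (rule value_matI[OF n_pos _ F sr cW P]) (simp add: state_dims)
  have v': "value_mat p A' B' C' Q R K = Ti\<^sup>T * P * Ti"
    by (rule similar_value[OF K cQ cR P])
  note dims = state_dims carrier_matD[OF cP] carrier_matD[OF Sig]
  have "Ti\<^sup>T * P * Ti * (T * \<Sigma> * T\<^sup>T) = Ti\<^sup>T * (P * \<Sigma> * T\<^sup>T)"
    by (simp add: assoc_mult_dim cancels dims)
  then have "cost p A' B' C' Q R (T * \<Sigma> * T\<^sup>T) K = mtrace (Ti\<^sup>T * (P * \<Sigma> * T\<^sup>T))"
    by (simp only: cost_def v')
  also have "\<dots> = mtrace (P * \<Sigma> * T\<^sup>T * Ti\<^sup>T)"
    by (rule mtrace_comm[of _ n n]; rule carrier_matI) (simp_all add: dims)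
  also have "P * \<Sigma> * T\<^sup>T * Ti\<^sup>T = P * \<Sigma>"
  proof -
    have "P * \<Sigma> * T\<^sup>T * Ti\<^sup>T = P * \<Sigma> * (T\<^sup>T * Ti\<^sup>T)"
      by (rule assoc_mult_dim) (simp_all add: dims)
    also have "\<dots> = P * \<Sigma>"
      unfolding transpose_T_Ti by (rule right_mult_one_mat[of _ n]) (use cP Sig in simp)
    finally show ?thesis .
  qed
  finally show ?thesis by (simp only: cost_def v)
qed

theorem similar_optimal_policy:
  assumes Q: "psd d Q" and R: "psd m R" and Sig: "\<Sigma> \<in> carrier_mat n n"
  shows "optimal_policy p A' B' C' Q R (T * \<Sigma> * T\<^sup>T) K \<longleftrightarrow> optimal_policy p A B C Q R \<Sigma> K"
  unfolding optimal_policy_def similar_feasible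
  using similar_cost[OF _ Q R Sig] by auto

end

section \<open>The optimal policies of the transformed system\<close>

theorem lemma5:
  fixes n m d p :: nat
    and A B C Q R T Pstar Kstar K :: "real mat"
    and \<Omega> :: "'w measure" and x0 :: "'w \<Rightarrow> real Matrix.vec"
  defines "p \<equiv> max (obsv_index C A) (ctrb_index A B)"
    and "Kstar \<equiv> K_opt p A B C R Pstar"
  assumes "0 < n" "0 < m" "0 < d"
    and "A \<in> carrier_mat n n" "B \<in> carrier_mat n m" "C \<in> carrier_mat d n"
    and "controllable A B" "observable C A"
    and "psd d Q" "pd m R"
    and "prob_space \<Omega>" "square_integrable_vec n \<Omega> x0"
    and "\<And>i. i < n \<Longrightarrow> (\<integral>\<omega>. x0 \<omega> $ i \<partial>\<Omega>) = 0"
    and "pd n (second_moment n \<Omega> x0)"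
    and "riccati_psd_solution A B C Q R Pstar"
    and "\<And>P. riccati_psd_solution A B C Q R P \<Longrightarrow> P = Pstar"
    and "Kstar \<in> feasible p A B C"
    and "T \<in> carrier_mat n n" "invertible_mat T"
  shows "optimal_policy p (T * A * minv T) (T * B) (C * minv T) Q R
           (second_moment n \<Omega> (\<lambda>\<omega>. T *\<^sub>v x0 \<omega>)) K
     \<longleftrightarrow> K \<in> {Kstar + \<Delta> | \<Delta>. \<Delta> \<in> carrier_mat m (p * (m + d)) \<and>
              \<Delta> * S_pinv p A B C = 0\<^sub>m m n}"
proof -
  note A = assms(6) and B = assms(7) and C = assms(8) and T = assms(20)
  have ip: "obsv_index C A \<le> p" "ctrb_index A B \<le> p" by (simp_all add: p_def)
  have "det T \<noteq> 0" by (rule invertible_mat_det_nonzero[OF T assms(21)])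
  note inv = minv_inverts[OF T this]
  interpret similar_system n m d p A B C T "minv T"
  proof
    fix v :: "real Matrix.vec" assume v: "v \<in> carrier_vec n"
    show "v = 0\<^sub>v n" if "obsv_mat p C A *\<^sub>v v = 0\<^sub>v (p * d)"
      by (rule obsv_mat_kernel_trivial[OF A C assms(10) ip(1) v that])
    show "v = 0\<^sub>v n" if "(ctrb_mat p A B)\<^sup>T *\<^sub>v v = 0\<^sub>v (p * m)"
      by (rule ctrb_mat_kernel_trivial[OF A B assms(9) ip(2) v that])
  qed (use assms(3) A B C T inv in auto)
  interpret lq_problem n m d p A B C Q R Pstar \<Omega> x0
    by unfold_locales (fact assms)+
  have star: "K_opt p A B C R Pstar \<in> feasible p A B C" using assms(19) by (simp only: Kstar_def)
  \<comment> \<open>\<open>Kstar = gain * S\<close> and \<open>S * Sp = 1\<close>; hence \<open>K * Sp = gain\<close> says that \<open>K - Kstar\<close> annihilates \<open>Sp\<close>.\<close>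
  have cs: "Kstar \<in> carrier_mat m q" and sp: "Kstar * Sp = gain"
    unfolding Kstar_def by (rule K_opt_carrier K_opt_Sp)+
  have "optimal_policy p (T * A * minv T) (T * B) (C * minv T) Q R
      (second_moment n \<Omega> (\<lambda>\<omega>. T *\<^sub>v x0 \<omega>)) K
    \<longleftrightarrow> optimal_policy p A B C Q R \<Sigma> K"
    unfolding second_moment_linear_image[OF assms(14) T]
    by (rule similar_optimal_policy[OF assms(11) pd_imp_psd[OF assms(12)] second_moment_carrier])
  also have "\<dots> \<longleftrightarrow> K \<in> carrier_mat m q \<and> K * Sp = gain"
    by (rule optimal_policy_iff[OF star])
  also have "\<dots> \<longleftrightarrow> (\<exists>\<Delta>. K = Kstar + \<Delta> \<and> \<Delta> \<in> carrier_mat m q \<and> \<Delta> * Sp = 0\<^sub>m m n)"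
  proof
    assume K: "K \<in> carrier_mat m q \<and> K * Sp = gain"
    have "K = Kstar + (K - Kstar)" by (rule eq_matI) (use K cs in auto)
    moreover have "K - Kstar \<in> carrier_mat m q" using cs by (rule minus_carrier_mat)
    moreover have "(K - Kstar) * Sp = 0\<^sub>m m n"
      unfolding minus_mult_distrib_mat[OF conjunct1[OF K] cs Sp] conjunct2[OF K] sp
      by (rule minus_r_inv_mat[OF gain])
    ultimately show "\<exists>\<Delta>. K = Kstar + \<Delta> \<and> \<Delta> \<in> carrier_mat m q \<and> \<Delta> * Sp = 0\<^sub>m m n" by blast
  next
    assume "\<exists>\<Delta>. K = Kstar + \<Delta> \<and> \<Delta> \<in> carrier_mat m q \<and> \<Delta> * Sp = 0\<^sub>m m n"
    then obtain \<Delta> where D: "K = Kstar + \<Delta>" "\<Delta> \<in> carrier_mat m q" "\<Delta> * Sp = 0\<^sub>m m n" by blast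
    have "K * Sp = gain"
      unfolding D(1) add_mult_distrib_mat[OF cs D(2) Sp] sp D(3) by (rule right_add_zero_mat[OF gain])
    then show "K \<in> carrier_mat m q \<and> K * Sp = gain" using D cs by simp
  qed
  finally show ?thesis by blast
qed

end
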